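(* Suppose $Q_{\mathrm{init}}\in C^1[0,1]$ is non-decreasing, $Q_{\mathrm{init}}(0)=0$, $Q_{\mathrm{init}}(1)=\Phi_F$, and $$\frac{d}{d\eta}Q_{\mathrm{init}}(1)>K(\Phi_F),\qquad \frac{d}{d\eta}Q_{\mathrm{init}}(1)-\frac{d}{d\eta}Q_{\mathrm{init}}(0)=K(\Phi_F)-K(0).$$ Then there exists a unique classical solution $(Q,N)$ of system (S) with initial datum $Q_{\mathrm{init}}$ on the time interval $[0,\tau^* )$, where $0<\tau^*\le+\infty$ is the maximal existence time. In addition, if $\tau^*<+\infty$, then $$\lim_{\tau\to(\tau^* )^-}N(\tau)=+\infty.$$
   Context: Standing assumptions: $\Phi_F>0$ is fixed and $K\in C^2(\mathbb{R})$ is a function with $K',K''$ bounded on $\mathbb{R}$ and $K(\phi)>0$ for $\phi\in[0,\Phi_F]$. System (S), for unknowns $Q(\tau,\eta)$ and $N(\tau)$: $$\partial_\tau Q+\partial_\eta Q=\frac1{N(\tau)}+K(Q)\quad(\tau>0,\ \eta\in(0,1)),\qquad Q(\tau,0)=0\quad(\tau>0),$$ $$\frac1{N(\tau)}=\partial_\eta Q(\tau,1)-K(\Phi_F)\quad(\tau>0),\qquad Q(0,\eta)=Q_{\mathrm{init}}(\eta)\quad(\eta\in[0,1]).$$ Classical solution: given $0<T\le+\infty$ and an initial datum $Q_{\mathrm{init}}\in C^1[0,1]$ that is increasing with $Q_{\mathrm{init}}(0)=0$, $Q_{\mathrm{init}}(1)=\Phi_F$ and $\frac{d}{d\eta}Q_{\mathrm{init}}(1)>K(\Phi_F)$,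 a pair $(Q,N)$ is a classical solution of (S) on $[0,T)$ if (1) $Q\in C^1([0,T)\times[0,1])$ is increasing in $\eta$ and $N\in C[0,T)$ is positive; (2) the equations of (S) hold in the classical sense for $\tau\in[0,T)$; (3) $K(\Phi_F)<\partial_\eta Q(\tau,1)<+\infty$ for all $\tau\in[0,T)$. Here "increasing" means non-decreasing. The maximal existence time $\tau^*$ is the supremum of all $T$ for which a classical solution on $[0,T)$ with the given initial datum exists. *)

theory Defs
  imports "HOL-Analysis.Analysis"
begin

(* The time interval [0,T) with 0 < T \<le> \<infinity>. *)
definition time_interval :: "ereal \<Rightarrow> real set" where
  "time_interval T = {\<tau>. 0 \<le> \<tau> \<and> ereal \<tau> < T}"

(* Qt and Qe are the partial derivatives of Q in \<tau> and \<eta> on [0,T) x [0,1], one-sided at the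
   boundary, and both are jointly continuous up to the boundary: together, Q is C^1 on that set.
   For T > 0 the functions Qt and Qe are determined by Q on [0,T) x [0,1]. *)
definition C1_with_partials ::
    "ereal \<Rightarrow> (real \<Rightarrow> real \<Rightarrow> real) \<Rightarrow> (real \<Rightarrow> real \<Rightarrow> real) \<Rightarrow> (real \<Rightarrow> real \<Rightarrow> real) \<Rightarrow> bool" where
  "C1_with_partials T Q Qt Qe \<longleftrightarrow>
     (\<forall>\<tau>\<in>time_interval T. \<forall>\<eta>\<in>{0..1}.
        ((\<lambda>s. Q s \<eta>) has_real_derivative Qt \<tau> \<eta>) (at \<tau> within time_interval T) \<and>
        ((\<lambda>y. Q \<tau> y) has_real_derivative Qe \<tau> \<eta>) (at \<eta> within {0..1})) \<and>
     continuous_on (time_interval T \<times> {0..1}) (\<lambda>(\<tau>, \<eta>). Qt \<tau> \<eta>) \<and>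
     continuous_on (time_interval T \<times> {0..1}) (\<lambda>(\<tau>, \<eta>). Qe \<tau> \<eta>)"

(* Only the values of Q on [0,T) x [0,1] and of N on [0,T) matter.  The equations are required
   on all of [0,T); given C^1 regularity of Q and continuity and positivity of N, this is the same
   as requiring them on (0,T) only.  The finiteness of the derivative of Q in \<eta> at \<eta> = 1 is
   implicit in Qe being real-valued. *)
definition classical_solution ::
    "real \<Rightarrow> (real \<Rightarrow> real) \<Rightarrow> (real \<Rightarrow> real) \<Rightarrow> ereal \<Rightarrow> (real \<Rightarrow> real \<Rightarrow> real) \<Rightarrow> (real \<Rightarrow> real) \<Rightarrow> bool" where
  "classical_solution \<Phi>\<^sub>F K Qinit T Q N \<longleftrightarrow>
     0 < T \<and>
     (\<exists>Qt Qe.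
        C1_with_partials T Q Qt Qe \<and>
        (\<forall>\<tau>\<in>time_interval T. mono_on {0..1} (Q \<tau>)) \<and>
        continuous_on (time_interval T) N \<and>
        (\<forall>\<tau>\<in>time_interval T. 0 < N \<tau>) \<and>
        (\<forall>\<tau>\<in>time_interval T. \<forall>\<eta>\<in>{0<..<1}. Qt \<tau> \<eta> + Qe \<tau> \<eta> = 1 / N \<tau> + K (Q \<tau> \<eta>)) \<and>
        (\<forall>\<tau>\<in>time_interval T. Q \<tau> 0 = 0) \<and>
        (\<forall>\<tau>\<in>time_interval T. 1 / N \<tau> = Qe \<tau> 1 - K \<Phi>\<^sub>F) \<and>
        (\<forall>\<eta>\<in>{0..1}. Q 0 \<eta> = Qinit \<eta>) \<and>
        (\<forall>\<tau>\<in>time_interval T. K \<Phi>\<^sub>F < Qe \<tau> 1))"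

definition maximal_existence_time :: "real \<Rightarrow> (real \<Rightarrow> real) \<Rightarrow> (real \<Rightarrow> real) \<Rightarrow> ereal" where
  "maximal_existence_time \<Phi>\<^sub>F K Qinit = Sup {T. \<exists>Q N. classical_solution \<Phi>\<^sub>F K Qinit T Q N}"

end

theory Submission
  imports Defs
begin

text \<open>
Write \<open>F q = K q - K 0\<close>.  The idea is to drop the requirement \<open>N > 0\<close>, to solve the resulting
relaxed problem for all times, and to recognise the maximal existence time as the first time at
which the relaxed \<open>1 / N\<close> vanishes.

Along a characteristic \<open>\<tau> - \<eta> = s\<close> the equation is the ordinary differential equation
\<open>q' = 1 / N + K q\<close>.  Let \<open>E\<close> be the function on \<open>[-1, \<infinity>)\<close> with \<open>E s = - Qinit (- s)\<close> for
\<open>s \<le> 0\<close> and \<open>E' = 1 / N + K 0\<close> for positive times.  Integration along the characteristic gives,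
whether it starts on the initial line or on the boundary, the same formula
\<open>Q \<tau> \<eta> = E \<tau> - E (\<tau> - \<eta>) + \<integral> F (Q r (r - (\<tau> - \<eta>))) dr\<close>, the integral running over the times
\<open>max (\<tau> - \<eta>) 0 \<le> r \<le> \<tau>\<close> that the characteristic has spent in the domain.  The constant \<open>K 0\<close> is
moved into \<open>E\<close> because \<open>F\<close> then vanishes on the boundary, where \<open>Q = 0\<close>: characteristics that enter
one shortly after the other have the slope of \<open>E\<close> as their difference quotient on entry.  At \<open>\<eta> = 1\<close>
the boundary equation for \<open>N\<close> and the equation at \<open>\<eta> = 1\<close> give
\<open>\<partial>\<^sub>\<tau> Q = K Q - K \<Phi>\<close>, so that \<open>Q \<tau> 1 = \<Phi>\<close> for all times.  Conversely \<open>Q \<tau> 1 = \<Phi>\<close> together with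
the formula is a delay equation which determines \<open>E\<close>.  No derivative occurs in this
system, and \<open>F\<close> is globally Lipschitz; in a norm weighted by a rapidly growing exponential in time
both the integral terms and the delayed term become small, so a contraction argument yields a
unique solution for all times at once (\<open>integral_solution_unique\<close>, \<open>integral_solution_exists\<close>).

Smoothness of this continuous solution comes from an exact formula: the difference of \<open>Q\<close> on two
characteristics solves a scalar linear equation, so it is the difference of the starting values
times an exponential (\<open>path_increment\<close>).  Dividing and passing to the limit gives
\<open>\<partial>\<^sub>\<eta> Q = E' (\<tau> - \<eta>) exp (\<integral> K' Q)\<close> wherever \<open>E\<close> is continuously differentiable up to time
\<open>\<tau> - \<eta>\<close> (\<open>increment_quotient\<close>).  Reading this off at \<open>\<eta> = 1\<close> shows that \<open>E\<close> is then
continuously differentiable for one more unit of time, and the compatibility condition on \<open>Qinit\<close>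
is exactly what makes \<open>E'\<close> continuous at time 0, where the induction starts (\<open>E_C1_up_to\<close>).

Any classical solution solves the integral form (\<open>classical_path\<close>), hence agrees with the
relaxed solution, whose \<open>1 / N\<close> must therefore be positive as long as the classical solution lives.
Conversely the relaxed solution is classical as long as its \<open>1 / N\<close> is positive
(\<open>relaxed_is_classical\<close>): positivity makes the boundary slope \<open>1 / N + K 0\<close> nonnegative,
the initial slope is nonnegative by monotonicity, and \<open>\<partial>\<^sub>\<eta> Q\<close> inherits the sign.  So \<open>\<tau>*\<close> is the first zero of the continuous function \<open>1 / N\<close>, and \<open>N\<close> tends
to infinity there.
\<close>

section \<open>Averages and integrals with parameters\<close>

text \<open>
The mean value of \<open>f\<close> over the segment from \<open>a\<close> to \<open>b\<close>, written over the fixed interval \<open>[0, 1]\<close>: in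
this form it makes sense for \<open>a = b\<close> and \<open>a > b\<close> and depends continuously on all data, so it can
serve as a quotient by \<open>b - a\<close> that survives the limit \<open>b \<rightarrow> a\<close>.
\<close>
definition average :: "(real \<Rightarrow> real) \<Rightarrow> real \<Rightarrow> real \<Rightarrow> real" where
  "average f a b = integral {0..1} (\<lambda>u. f (a + u * (b - a)))"

lemma average_same [simp]: "average f a a = f a"
  by (simp add: average_def)

lemma integral_eq_average:
  fixes f :: "real \<Rightarrow> real"
  assumes "a \<le> b" "continuous_on {a..b} f"
  shows "integral {a..b} f = (b - a) * average f a b"
proof (cases "a = b")
  case False
  then have ab: "a < b" using assms by simp
  have "(f has_integral integral {a..b} f) (cbox a b)"
    using assms(2) by (simp add: integrable_continuous_real integrable_integral)
  from has_integral_affinity'[OF this, of "b - a" a] ab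
  have "((\<lambda>u. f ((b - a) * u + a)) has_integral (integral {a..b} f / (b - a))) {0..1}"
    by (simp add: divide_inverse mult.commute)
  then have "average f a b = integral {a..b} f / (b - a)"
    by (simp add: average_def integral_unique algebra_simps)
  then show ?thesis using ab by simp
qed simp

lemma increment_eq_average:
  assumes "\<And>x. (f has_real_derivative f' x) (at x)"
  shows "f y - f x = average f' x y * (y - x)"
proof -
  have "((\<lambda>u. f' (x + u * (y - x)) * (y - x)) has_integral (f (x + 1 * (y - x)) - f (x + 0 * (y - x)))) {0..1}"
  proof (rule fundamental_theorem_of_calculus)
    fix u :: real
    have "((\<lambda>u. f (x + u * (y - x))) has_real_derivative f' (x + u * (y - x)) * (y - x)) (at u within {0..1})"
      by (rule DERIV_chain2[OF assms(1)]) (auto intro!: derivative_eq_intros)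
    then show "((\<lambda>u. f (x + u * (y - x))) has_vector_derivative f' (x + u * (y - x)) * (y - x)) (at u within {0..1})"
      by (simp add: has_real_derivative_iff_has_vector_derivative)
  qed simp
  then show ?thesis
    by (simp add: average_def integral_unique flip: integral_mult_left)
qed

lemma continuous_on_average:
  fixes f :: "'a::topological_space \<Rightarrow> real \<Rightarrow> real"
  assumes f: "continuous_on UNIV (\<lambda>(x, r). f x r)"
    and a: "continuous_on S a" and b: "continuous_on S b"
  shows "continuous_on S (\<lambda>x. average (f x) (a x) (b x))"
proof -
  have "continuous_on (S \<times> {0..1}) (\<lambda>z. (\<lambda>(x, r). f x r) (fst z, a (fst z) + snd z * (b (fst z) - a (fst z))))"
    by (rule continuous_on_compose2[OF f])
       (auto intro!: continuous_intros continuous_on_compose2[OF a] continuous_on_compose2[OF b])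
  then have "continuous_on (S \<times> cbox 0 1) (\<lambda>(x, u). f x (a x + u * (b x - a x)))"
    by (simp add: case_prod_unfold)
  from integral_continuous_on_param[OF this] show ?thesis
    by (simp add: average_def)
qed

lemma continuous_on_param_apply:
  assumes "continuous_on UNIV (\<lambda>(x, r). f x r)"
  shows "continuous_on S (f x)"
proof -
  have "continuous_on S (\<lambda>r. (\<lambda>(x, r). f x r) (x, r))"
    by (rule continuous_on_compose2[OF assms]) (auto intro!: continuous_intros)
  then show ?thesis by simp
qed

lemma continuous_on_integral_param:
  fixes f :: "'a::topological_space \<Rightarrow> real \<Rightarrow> real"
  assumes f: "continuous_on UNIV (\<lambda>(x, r). f x r)"
    and a: "continuous_on S a" and b: "continuous_on S b"
    and le: "\<And>x. x \<in> S \<Longrightarrow> a x \<le> b x"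
  shows "continuous_on S (\<lambda>x. integral {a x..b x} (f x))"
proof -
  have "continuous_on S (\<lambda>x. (b x - a x) * average (f x) (a x) (b x))"
    by (intro continuous_intros continuous_on_average[OF f] a b)
  then show ?thesis
    by (rule continuous_on_eq) (simp add: integral_eq_average[OF le continuous_on_param_apply[OF f]])
qed

lemma tendsto_average:
  fixes f :: "'a::topological_space \<Rightarrow> real \<Rightarrow> real"
  assumes f: "continuous_on UNIV (\<lambda>(x, r). f x r)"
    and p: "(p \<longlongrightarrow> x) G" and a: "(a \<longlongrightarrow> r) G" and b: "(b \<longlongrightarrow> r) G"
  shows "((\<lambda>z. average (f (p z)) (a z) (b z)) \<longlongrightarrow> f x r) G"
proof -
  have "continuous_on UNIV (\<lambda>(w, r). f (fst w) r)"
  proof -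
    have "continuous_on UNIV (\<lambda>z. (\<lambda>(x, r). f x r) (fst (fst z), snd z))"
      by (rule continuous_on_compose2[OF f]) (auto intro!: continuous_intros)
    then show ?thesis by (simp add: case_prod_unfold)
  qed
  then have "continuous_on UNIV (\<lambda>w. average (f (fst w)) (fst (snd w)) (snd (snd w)))"
    by (rule continuous_on_average) (intro continuous_intros)+
  from continuous_on_tendsto_compose[OF this, of "\<lambda>z. (p z, a z, b z)" "(x, r, r)" G]
    tendsto_Pair[OF p tendsto_Pair[OF a b]]
  show ?thesis by simp
qed

section \<open>Difference quotients, scalar linear equations, weighted contractions\<close>

text \<open>
For a continuously differentiable function both end points of the difference quotient may move:
by the mean value theorem the quotient is a value of the derivative at a point squeezed between them.
\<close>
lemma strict_difference_quotient:
  fixes u v :: "'a \<Rightarrow> real"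
  assumes f: "\<And>s. s \<in> {a..b} \<Longrightarrow> (f has_real_derivative f' s) (at s within {a..b})"
    and f': "continuous_on {a..b} f'"
    and u: "(u \<longlongrightarrow> s) G" and v: "(v \<longlongrightarrow> s) G" and s: "s \<in> {a..b}"
    and uv: "\<forall>\<^sub>F z in G. a \<le> u z \<and> u z < v z \<and> v z \<le> b"
  shows "((\<lambda>z. (f (v z) - f (u z)) / (v z - u z)) \<longlongrightarrow> f' s) G"
proof -
  have "\<exists>\<xi>. (a \<le> u z \<and> u z < v z \<and> v z \<le> b) \<longrightarrow>
      u z \<le> \<xi> \<and> \<xi> \<le> v z \<and> (f (v z) - f (u z)) / (v z - u z) = f' \<xi>" for z
  proof (cases "a \<le> u z \<and> u z < v z \<and> v z \<le> b")
    case True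
    have "\<exists>\<xi>\<in>{u z<..<v z}. f (v z) - f (u z) = f' \<xi> * (v z - u z)"
    proof (rule mvt_simple)
      fix x assume "u z \<le> x" "x \<le> v z"
      then have "(f has_real_derivative f' x) (at x within {u z..v z})"
        using f[of x] True by (auto intro: has_field_derivative_subset)
      then show "(f has_derivative (*) (f' x)) (at x within {u z..v z})"
        by (simp add: has_field_derivative_def)
    qed (use True in simp)
    then obtain \<xi> where "\<xi> \<in> {u z<..<v z}" "f (v z) - f (u z) = f' \<xi> * (v z - u z)" ..
    then show ?thesis by (intro exI[of _ \<xi>]) simp
  qed blast
  then obtain \<xi> where \<xi>: "\<And>z. a \<le> u z \<and> u z < v z \<and> v z \<le> b \<Longrightarrow>
      u z \<le> \<xi> z \<and> \<xi> z \<le> v z \<and> (f (v z) - f (u z)) / (v z - u z) = f' (\<xi> z)"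
    by metis
  have "(\<xi> \<longlongrightarrow> s) G"
    by (rule tendsto_sandwich[OF _ _ u v]; use uv in eventually_elim) (use \<xi> in force)+
  moreover have "\<forall>\<^sub>F z in G. \<xi> z \<in> {a..b}"
    using uv by eventually_elim (use \<xi> in force)
  ultimately have "((\<lambda>z. f' (\<xi> z)) \<longlongrightarrow> f' s) G"
    by (intro continuous_on_tendsto_compose[OF f' _ s])
  then show ?thesis
    by (rule Lim_transform_eventually) (use uv in \<open>eventually_elim, simp add: \<xi>\<close>)
qed

text \<open>
One-sided derivatives glue.  A point outside one of the closed pieces is not a limit point of that
piece, so the limit along it is vacuous there.
\<close>
lemma has_real_derivative_Un:
  assumes "closed S" "closed T" "x \<in> S \<union> T"
    and "x \<in> S \<Longrightarrow> (f has_real_derivative d) (at x within S)"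
    and "x \<in> T \<Longrightarrow> (f has_real_derivative d) (at x within T)"
  shows "(f has_real_derivative d) (at x within (S \<union> T))"
proof -
  have "((\<lambda>y. (f y - f x) / (y - x)) \<longlongrightarrow> d) (at x within A)"
    if "closed A" "x \<in> A \<Longrightarrow> (f has_real_derivative d) (at x within A)" for A
  proof (cases "x \<in> A")
    case False
    then have "at x within A = bot"
      using \<open>closed A\<close> by (auto simp: trivial_limit_within closed_limpt)
    then show ?thesis by simp
  qed (use that in \<open>simp add: has_field_derivative_iff\<close>)
  from this[OF assms(1,4)] this[OF assms(2,5)] show ?thesis
    unfolding has_field_derivative_iff by (simp add: at_within_union filterlim_sup)
qed

lemma tendsto_min_max_id:
  fixes t :: real
  shows "((\<lambda>x. min x t) \<longlongrightarrow> t) (at t within S)" "((\<lambda>x. max x t) \<longlongrightarrow> t) (at t within S)"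
  using tendsto_min[OF tendsto_ident_at[of t S] tendsto_const[of t]]
    tendsto_max[OF tendsto_ident_at[of t S] tendsto_const[of t]] by simp_all

text \<open>
Writing the difference quotient with the smaller and the larger point treats the left and the right
derivative together in arguments that need to know which of two times comes first.
\<close>
lemma derivative_iff_min_max_quotient:
  fixes f :: "real \<Rightarrow> real"
  shows "(f has_real_derivative d) (at t within S) \<longleftrightarrow>
    ((\<lambda>x. (f (max x t) - f (min x t)) / (max x t - min x t)) \<longlongrightarrow> d) (at t within S)"
proof -
  have "(f (max x t) - f (min x t)) / (max x t - min x t) = (f x - f t) / (x - t)" for x
    using minus_divide_divide[of "f x - f t" "x - t"] by (cases "x \<le> t") simp_all
  then show ?thesis by (simp add: has_field_derivative_iff)
qed

lemma real_derivative_unique_Icc: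
  fixes a b :: real
  assumes "a < b" "x \<in> {a..b}" "{a..b} \<subseteq> S"
    and "(f has_real_derivative d) (at x within S)" "(f has_real_derivative e) (at x within S)"
  shows "d = e"
  using assms vector_derivative_unique_within_closed_interval[of a b x f d e]
    has_field_derivative_subset[of f _ x S "{a..b}"]
  by (simp add: has_real_derivative_iff_has_vector_derivative)

text \<open>
The product of \<open>D\<close> with the integrating factor \<open>exp (- \<integral> k)\<close> has derivative zero.
\<close>
lemma linear_ode_solution:
  fixes D k :: "real \<Rightarrow> real"
  assumes "a \<le> b" and k: "continuous_on {a..b} k"
    and D: "\<And>t. t \<in> {a..b} \<Longrightarrow> (D has_real_derivative k t * D t) (at t within {a..b})"
  shows "D b = D a * exp (integral {a..b} k)"
proof -
  define G where "G t = D t * exp (- integral {a..t} k)" for t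
  have "(G has_real_derivative 0) (at t within {a..b})" if "t \<in> {a..b}" for t
    unfolding G_def
    by (rule derivative_eq_intros D[OF that] integral_has_real_derivative[OF k that] refl)+
       (simp add: algebra_simps)
  from has_field_derivative_zero_constant[OF _ this] obtain c where c: "\<And>t. t \<in> {a..b} \<Longrightarrow> G t = c"
    by auto
  have "G b = G a" using c \<open>a \<le> b\<close> by simp
  then show ?thesis by (simp add: G_def exp_minus field_simps)
qed

text \<open>
Banach's fixed point theorem in the space of continuous functions of growth at most \<open>w\<close>, obtained
from the space of bounded continuous functions by dividing by \<open>w\<close>.
\<close>
lemma weighted_contraction_fixpoint:
  fixes G :: "('a::metric_space \<Rightarrow> 'b::banach) \<Rightarrow> 'a \<Rightarrow> 'b" and w :: "'a \<Rightarrow> real"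
  assumes w_pos: "\<And>x. 0 < w x" and w_cont: "continuous_on UNIV w"
    and G_cont: "\<And>f. continuous_on UNIV f \<Longrightarrow> continuous_on UNIV (G f)"
    and G_zero: "\<And>x. norm (G (\<lambda>_. 0) x) \<le> M\<^sub>0 * w x"
    and G_contr: "\<And>f g M x. continuous_on UNIV f \<Longrightarrow> continuous_on UNIV g \<Longrightarrow>
      (\<And>x. norm (f x - g x) \<le> M * w x) \<Longrightarrow> norm (G f x - G g x) \<le> M / 2 * w x"
  obtains f where "continuous_on UNIV f" "\<And>x. G f x = f x"
proof -
  define ext where "ext u x = w x *\<^sub>R apply_bcontfun u x" for u :: "'a \<Rightarrow>\<^sub>C 'b" and x
  define \<Gamma> where "\<Gamma> u = Bcontfun (\<lambda>x. inverse (w x) *\<^sub>R G (ext u) x)" for u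
  have w_nz: "w x \<noteq> 0" for x using w_pos[of x] by simp
  have ext_cont: "continuous_on UNIV (ext u)" for u
    unfolding ext_def by (intro continuous_intros w_cont) auto
  have mem: "(\<lambda>x. inverse (w x) *\<^sub>R G (ext u) x) \<in> bcontfun" for u
  proof (rule bcontfun_normI)
    show "continuous_on UNIV (\<lambda>x. inverse (w x) *\<^sub>R G (ext u) x)"
      by (intro continuous_intros w_cont G_cont ext_cont) (use w_nz in auto)
    fix x
    have "norm (ext u x - (\<lambda>_. 0) x) \<le> norm u * w x" for x
      using norm_bounded[of u x] w_pos[of x] by (simp add: ext_def mult.commute)
    then have "norm (G (ext u) x - G (\<lambda>_. 0) x) \<le> norm u / 2 * w x"
      by (intro G_contr ext_cont continuous_on_const)
    then have "norm (G (ext u) x) \<le> (norm u / 2 + M\<^sub>0) * w x"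
      using G_zero[of x] norm_triangle_sub[of "G (ext u) x" "G (\<lambda>_. 0) x"] by (simp add: algebra_simps)
    then show "norm (inverse (w x) *\<^sub>R G (ext u) x) \<le> norm u / 2 + M\<^sub>0"
      using w_pos[of x] by (simp add: field_simps)
  qed
  have apply_\<Gamma>: "apply_bcontfun (\<Gamma> u) x = inverse (w x) *\<^sub>R G (ext u) x" for u x
    unfolding \<Gamma>_def by (simp add: Bcontfun_inverse[OF mem])
  have "dist (\<Gamma> u) (\<Gamma> v) \<le> 1/2 * dist u v" for u v
  proof (rule dist_bound)
    fix x
    have "norm (ext u x - ext v x) \<le> dist u v * w x" for x
      using dist_bounded[of u x v] w_pos[of x]
      by (simp add: ext_def dist_norm mult.commute flip: scaleR_diff_right)
    then have "norm (G (ext u) x - G (ext v) x) \<le> dist u v / 2 * w x"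
      by (intro G_contr ext_cont)
    then have "inverse (w x) * norm (G (ext u) x - G (ext v) x) \<le> 1/2 * dist u v"
      using w_pos[of x] by (simp add: field_simps)
    moreover have "dist (apply_bcontfun (\<Gamma> u) x) (apply_bcontfun (\<Gamma> v) x)
        = inverse (w x) * norm (G (ext u) x - G (ext v) x)"
      using w_pos[of x] by (simp add: apply_\<Gamma> dist_norm flip: scaleR_diff_right)
    ultimately show "dist (apply_bcontfun (\<Gamma> u) x) (apply_bcontfun (\<Gamma> v) x) \<le> 1/2 * dist u v"
      by simp
  qed
  then obtain u where u: "\<Gamma> u = u"
    using banach_fix_type[of "1/2" \<Gamma>] by auto
  have "G (ext u) x = ext u x" for x
    using apply_\<Gamma>[of u x] w_nz[of x] unfolding u by (simp add: ext_def)
  then show ?thesis using that[OF ext_cont] by blast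
qed

section \<open>The integral form of the relaxed problem\<close>

text \<open>
The data of the relaxed problem.  The bound \<open>L\<close> is a Lipschitz constant of \<open>K\<close> on the whole line, and
this is what makes solutions of the relaxed problem live forever.
\<close>
locale relaxed_problem =
  fixes \<Phi> :: real and K K' :: "real \<Rightarrow> real" and L :: real and Qi Qi' :: "real \<Rightarrow> real"
  assumes K_deriv: "\<And>x. (K has_real_derivative K' x) (at x)"
    and K'_cont: "continuous_on UNIV K'"
    and L_pos: "0 < L" and K'_le: "\<And>x. \<bar>K' x\<bar> \<le> L"
    and Qi_deriv: "\<And>y. y \<in> {0..1} \<Longrightarrow> (Qi has_real_derivative Qi' y) (at y within {0..1})"
    and Qi'_cont: "continuous_on {0..1} Qi'"
    and Qi_0: "Qi 0 = 0" and Qi_1: "Qi 1 = \<Phi>"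
    and compat: "Qi' 1 - Qi' 0 = K \<Phi> - K 0"
begin

definition F :: "real \<Rightarrow> real" where "F q = K q - K 0"

lemma F_0 [simp]: "F 0 = 0" by (simp add: F_def)

lemma F_deriv: "(F has_real_derivative K' x) (at x)"
  unfolding F_def by (rule derivative_eq_intros K_deriv refl)+ simp

lemma F_lipschitz: "\<bar>F x - F y\<bar> \<le> L * \<bar>x - y\<bar>"
  using field_differentiable_bound[of UNIV F K' L x y] F_deriv K'_le by simp

lemma F_cont: "continuous_on S F"
  using F_deriv DERIV_isCont continuous_at_imp_continuous_on by blast

lemma Qi_cont: "continuous_on {0..1} Qi"
  using Qi_deriv DERIV_continuous continuous_on_eq_continuous_within by blast

text \<open>
The part of \<open>Q t y\<close> that the nonlinearity \<open>F\<close> has contributed along the characteristic through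
\<open>(t, y)\<close>, which entered the domain at time \<open>max (t - y) 0\<close>, through the initial line or through the
boundary \<open>y = 0\<close>.
\<close>
definition gain :: "(real \<Rightarrow> real \<Rightarrow> real) \<Rightarrow> real \<Rightarrow> real \<Rightarrow> real" where
  "gain Q t y = integral {max (t - y) 0..t} (\<lambda>r. F (Q r (r - (t - y))))"

lemma gain_integrand_cont:
  fixes t y :: real
  assumes "continuous_on ({0..t} \<times> {0..1}) (\<lambda>(t, y). Q t y)" "y \<in> {0..1}"
  shows "continuous_on {max (t - y) 0..t} (\<lambda>r. F (Q r (r - (t - y))))"
proof -
  have "continuous_on {max (t - y) 0..t} (\<lambda>r. (\<lambda>(t, y). Q t y) (r, r - (t - y)))"
  proof (rule continuous_on_compose2[OF assms(1)])
    show "continuous_on {max (t - y) 0..t} (\<lambda>r. (r, r - (t - y)))" by (intro continuous_intros)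
    show "(\<lambda>r. (r, r - (t - y))) ` {max (t - y) 0..t} \<subseteq> {0..t} \<times> {0..1}" using assms(2) by auto
  qed
  then have "continuous_on {max (t - y) 0..t} (\<lambda>r. Q r (r - (t - y)))" by simp
  then show ?thesis using continuous_on_compose2[OF F_cont[of UNIV]] by auto
qed

text \<open>
Integrating the weight \<open>exp (\<mu> r)\<close> in time gains the factor \<open>1 / \<mu>\<close>, which beats the Lipschitz
constant once \<open>\<mu>\<close> is large.
\<close>
lemma gain_diff_le:
  assumes "0 < \<mu>" "0 \<le> t" and y: "y \<in> {0..1}"
    and Q: "continuous_on ({0..t} \<times> {0..1}) (\<lambda>(t, y). Q t y)"
    and R: "continuous_on ({0..t} \<times> {0..1}) (\<lambda>(t, y). R t y)"
    and QR: "\<And>r x. r \<in> {0..t} \<Longrightarrow> x \<in> {0..1} \<Longrightarrow> \<bar>Q r x - R r x\<bar> \<le> M * exp (\<mu> * r)"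
  shows "\<bar>gain Q t y - gain R t y\<bar> \<le> L / \<mu> * (M * exp (\<mu> * t))"
proof -
  let ?a = "max (t - y) 0"
  note iQ = integrable_continuous_real[OF gain_integrand_cont[OF Q y]]
   and iR = integrable_continuous_real[OF gain_integrand_cont[OF R y]]
  have M: "0 \<le> M"
    using QR[of 0 0] \<open>0 \<le> t\<close> by simp
  have at: "?a \<le> t" using \<open>0 \<le> t\<close> y by simp
  have E: "((\<lambda>r. L * (M * exp (\<mu> * r))) has_integral
      L / \<mu> * (M * exp (\<mu> * t)) - L / \<mu> * (M * exp (\<mu> * ?a))) {?a..t}"
    by (rule fundamental_theorem_of_calculus[OF at])
       (use \<open>0 < \<mu>\<close> in \<open>auto intro!: derivative_eq_intros simp flip: has_real_derivative_iff_has_vector_derivative\<close>)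
  have "norm (integral {?a..t} (\<lambda>r. F (Q r (r - (t - y))) - F (R r (r - (t - y)))))
      \<le> integral {?a..t} (\<lambda>r. L * (M * exp (\<mu> * r)))"
  proof (rule integral_norm_bound_integral)
    show "(\<lambda>r. F (Q r (r - (t - y))) - F (R r (r - (t - y)))) integrable_on {?a..t}"
      by (rule integrable_diff[OF iQ iR])
    show "(\<lambda>r. L * (M * exp (\<mu> * r))) integrable_on {?a..t}" using E by blast
    fix r assume r: "r \<in> {?a..t}"
    have "\<bar>F (Q r (r - (t - y))) - F (R r (r - (t - y)))\<bar> \<le> L * \<bar>Q r (r - (t - y)) - R r (r - (t - y))\<bar>"
      by (rule F_lipschitz)
    also have "\<dots> \<le> L * (M * exp (\<mu> * r))"
      using QR[of r "r - (t - y)"] r y L_pos by (intro mult_left_mono) auto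
    finally show "norm (F (Q r (r - (t - y))) - F (R r (r - (t - y)))) \<le> L * (M * exp (\<mu> * r))" by simp
  qed
  also have "\<dots> \<le> L / \<mu> * (M * exp (\<mu> * t))"
    using integral_unique[OF E] M L_pos \<open>0 < \<mu>\<close> by simp
  finally show ?thesis
    by (simp add: gain_def integral_diff[OF iQ iR])
qed

lemma gain_cont:
  assumes "continuous_on UNIV (\<lambda>(t, y). Q t y)"
  shows "continuous_on ({0..} \<times> {0..}) (\<lambda>(t, y). gain Q t y)"
proof -
  have *: "continuous_on UNIV (\<lambda>(p, r). F (Q r (r - (fst p - snd p))))" (is "continuous_on _ ?f")
  proof -
    have "continuous_on UNIV (\<lambda>z. F ((\<lambda>(t, y). Q t y) (snd z, snd z - (fst (fst z) - snd (fst z)))))"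
      by (rule continuous_on_compose2[OF F_cont[of UNIV]], rule continuous_on_compose2[OF assms])
         (auto intro!: continuous_intros)
    then show ?thesis by (simp add: case_prod_unfold)
  qed
  have "continuous_on ({0..} \<times> {0..})
      (\<lambda>p. integral {max (fst p - snd p) 0..fst p} (\<lambda>r. F (Q r (r - (fst p - snd p)))))"
    by (rule continuous_on_integral_param[OF *]) (auto intro!: continuous_intros)
  then show ?thesis by (simp add: gain_def case_prod_unfold)
qed

text \<open>
On \<open>[0, T]\<close> the function \<open>E\<close> stands for \<open>\<integral> (1 / N + K 0)\<close> from 0, and on \<open>[-1, 0]\<close> it records the
initial datum as history, so that the same formula covers characteristics starting on the initial
line and on the boundary.
\<close>
definition integral_solution :: "real \<Rightarrow> (real \<Rightarrow> real \<Rightarrow> real) \<Rightarrow> (real \<Rightarrow> real) \<Rightarrow> bool" where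
  "integral_solution T Q E \<longleftrightarrow>
     continuous_on ({0..T} \<times> {0..1}) (\<lambda>(t, y). Q t y) \<and> continuous_on {-1..T} E \<and>
     (\<forall>s\<in>{-1..0}. E s = - Qi (- s)) \<and>
     (\<forall>t\<in>{0..T}. Q t 1 = \<Phi> \<and> (\<forall>y\<in>{0..1}. Q t y = E t - E (t - y) + gain Q t y))"

text \<open>
A growth rate for which both the integral term and a delay by one unit of time shrink the weight
\<open>exp (rate t)\<close> at least by the factor 48, which leaves room for the few such terms that are added up.
\<close>
definition rate :: real where "rate = 48 * (L + 1)"

lemma rate_pos: "0 < rate" and L_rate: "L / rate \<le> 1 / 48" and exp_rate: "exp (- rate) \<le> 1 / 48"
proof -
  show "0 < rate" "L / rate \<le> 1 / 48" using L_pos by (auto simp: rate_def field_simps)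
  have "48 \<le> exp rate" using exp_ge_add_one_self[of rate] L_pos by (simp add: rate_def)
  then show "exp (- rate) \<le> 1 / 48" by (simp add: exp_minus field_simps)
qed

lemma gain_diff_rate:
  assumes "0 \<le> t" "y \<in> {0..1}"
    and "continuous_on ({0..t} \<times> {0..1}) (\<lambda>(t, y). Q t y)" "continuous_on ({0..t} \<times> {0..1}) (\<lambda>(t, y). R t y)"
    and QR: "\<And>r x. r \<in> {0..t} \<Longrightarrow> x \<in> {0..1} \<Longrightarrow> \<bar>Q r x - R r x\<bar> \<le> M * exp (rate * r)"
  shows "\<bar>gain Q t y - gain R t y\<bar> \<le> M * exp (rate * t) / 48"
proof -
  have "0 \<le> M" using QR[of 0 0] \<open>0 \<le> t\<close> by simp
  have "\<bar>gain Q t y - gain R t y\<bar> \<le> L / rate * (M * exp (rate * t))"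
    by (rule gain_diff_le[OF rate_pos assms])
  also have "\<dots> \<le> 1 / 48 * (M * exp (rate * t))"
    using L_rate \<open>0 \<le> M\<close> by (intro mult_right_mono) auto
  finally show ?thesis by simp
qed

lemma delay_rate:
  assumes "0 \<le> M" "1 \<le> t"
  shows "M * exp (rate * (t - 1)) \<le> M * exp (rate * t) / 48" "M \<le> M * exp (rate * t) / 48"
proof -
  have "exp (rate * (t - 1)) = exp (- rate) * exp (rate * t)"
    by (simp add: algebra_simps flip: exp_add)
  also have "\<dots> \<le> 1 / 48 * exp (rate * t)" using exp_rate by (intro mult_right_mono) auto
  finally have *: "exp (rate * (t - 1)) \<le> exp (rate * t) / 48" by simp
  then show "M * exp (rate * (t - 1)) \<le> M * exp (rate * t) / 48"
    using mult_left_mono[OF * \<open>0 \<le> M\<close>] by simp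
  have "1 \<le> exp (rate * (t - 1))" using rate_pos assms by simp
  then have "1 \<le> exp (rate * t) / 48" using * by linarith
  from mult_left_mono[OF this \<open>0 \<le> M\<close>] show "M \<le> M * exp (rate * t) / 48" by simp
qed

text \<open>
The estimates of the contraction, applied to two given solutions on a bounded time interval: a bound
\<open>M exp (rate t)\<close> on their distance improves to \<open>M / 2 exp (rate t)\<close>, and so on to zero.  The increments
\<open>E t - E (t - y)\<close> are not small by themselves; the condition at \<open>y = 1\<close> first bounds the difference of
the functions \<open>E\<close> by a delayed term and an integral term.
\<close>
lemma integral_solution_unique:
  assumes QE: "integral_solution T Q E" and RG: "integral_solution T R G" and t: "t \<in> {0..T}"
  shows "E t = G t" and "y \<in> {0..1} \<Longrightarrow> Q t y = R t y"
proof -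
  note D = integral_solution_def
  have cont: "continuous_on ({0..r} \<times> {0..1}) (\<lambda>(t, y). Q t y)"
    "continuous_on ({0..r} \<times> {0..1}) (\<lambda>(t, y). R t y)" if "r \<in> {0..T}" for r
    using QE RG that unfolding D by (auto elim: continuous_on_subset)
  have hist: "E s = G s" if "s \<in> {-1..0}" for s using QE RG that unfolding D by auto
  define close where "close M \<longleftrightarrow> (\<forall>r\<in>{0..T}. \<bar>E r - G r\<bar> \<le> M * exp (rate * r) \<and>
    (\<forall>x\<in>{0..1}. \<bar>Q r x - R r x\<bar> \<le> M * exp (rate * r)))" for M
  have halve: "close (M / 2)" if M: "close M" for M
  proof -
    have M0: "0 \<le> M" using M t unfolding close_def by (auto dest!: bspec[of _ _ 0])
    have g: "\<bar>gain Q r x - gain R r x\<bar> \<le> M * exp (rate * r) / 48" if "r \<in> {0..T}" "x \<in> {0..1}" for r x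
      using that M by (intro gain_diff_rate cont) (auto simp: close_def)
    have e: "\<bar>E r - G r\<bar> \<le> M * exp (rate * r) / 24" if r: "r \<in> {0..T}" for r
    proof -
      have "\<Phi> = E r - E (r - 1) + gain Q r 1" "\<Phi> = G r - G (r - 1) + gain R r 1"
        using QE RG r unfolding D by (metis atLeastAtMost_iff order_refl zero_le_one)+
      then have "E r - G r = (E (r - 1) - G (r - 1)) - (gain Q r 1 - gain R r 1)" by simp
      moreover have "\<bar>E (r - 1) - G (r - 1)\<bar> \<le> M * exp (rate * r) / 48"
      proof (cases "r \<le> 1")
        case True then show ?thesis using hist[of "r - 1"] r M0 by simp
      next
        case False
        then have "\<bar>E (r - 1) - G (r - 1)\<bar> \<le> M * exp (rate * (r - 1))"
          using M r by (simp add: close_def)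
        then show ?thesis using delay_rate(1)[OF M0, of r] False by simp
      qed
      moreover have "\<bar>gain Q r 1 - gain R r 1\<bar> \<le> M * exp (rate * r) / 48" using g[OF r] by simp
      ultimately show ?thesis by linarith
    qed
    show ?thesis unfolding close_def
    proof (intro ballI conjI)
      fix r assume r: "r \<in> {0..T}"
      have p: "0 \<le> M * exp (rate * r)" using M0 by simp
      show "\<bar>E r - G r\<bar> \<le> M / 2 * exp (rate * r)" using e[OF r] p by simp
      fix x :: real assume x: "x \<in> {0..1}"
      have "\<bar>E (r - x) - G (r - x)\<bar> \<le> M * exp (rate * r) / 24"
      proof (cases "r \<le> x")
        case True then show ?thesis using hist[of "r - x"] r x p by simp
      next
        case False
        then have "\<bar>E (r - x) - G (r - x)\<bar> \<le> M * exp (rate * (r - x)) / 24" using e r x by simp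
        also have "\<dots> \<le> M * exp (rate * r) / 24"
          using M0 rate_pos x by (intro divide_right_mono mult_left_mono) auto
        finally show ?thesis .
      qed
      moreover have "Q r x = E r - E (r - x) + gain Q r x" "R r x = G r - G (r - x) + gain R r x"
        using QE RG r x unfolding D by auto
      ultimately show "\<bar>Q r x - R r x\<bar> \<le> M / 2 * exp (rate * r)"
        using e[OF r] g[OF r x] p by linarith
    qed
  qed
  \<comment> \<open>The halving needs a bound to start from, which compactness provides.\<close>
  obtain M where M: "close M"
  proof -
    have "continuous_on ({0..T} \<times> {0..1}) (\<lambda>z. (\<lambda>(t, y). Q t y) z - (\<lambda>(t, y). R t y) z)"
      using QE RG unfolding D by (intro continuous_on_diff) auto
    then have "compact ((\<lambda>(t, y). Q t y - R t y) ` ({0..T} \<times> {0..1}))"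
      by (intro compact_continuous_image compact_Times compact_Icc) (simp add: case_prod_unfold)
    moreover have "continuous_on {0..T} (\<lambda>t. E t - G t)"
      using QE RG unfolding D by (auto intro!: continuous_on_diff elim: continuous_on_subset)
    then have "compact ((\<lambda>t. E t - G t) ` {0..T})"
      by (intro compact_continuous_image compact_Icc)
    ultimately obtain A B where "\<forall>z\<in>(\<lambda>(t, y). Q t y - R t y) ` ({0..T} \<times> {0..1}). norm z \<le> A"
      "\<forall>z\<in>(\<lambda>t. E t - G t) ` {0..T}. norm z \<le> B"
      by (meson compact_imp_bounded bounded_iff)
    then have A: "\<And>t y. t \<in> {0..T} \<Longrightarrow> y \<in> {0..1} \<Longrightarrow> \<bar>Q t y - R t y\<bar> \<le> A"
      and B: "\<And>t. t \<in> {0..T} \<Longrightarrow> \<bar>E t - G t\<bar> \<le> B"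
      by auto
    have "\<bar>E r - G r\<bar> \<le> max A B * exp (rate * r) \<and>
        (\<forall>x\<in>{0..1}. \<bar>Q r x - R r x\<bar> \<le> max A B * exp (rate * r))" if r: "r \<in> {0..T}" for r
    proof -
      have "0 \<le> max A B" using B[OF r] by simp
      then have "max A B * 1 \<le> max A B * exp (rate * r)"
        using rate_pos r by (intro mult_left_mono) auto
      then show ?thesis using A[OF r] B[OF r] by (fastforce intro: order_trans)
    qed
    then show ?thesis using that[of "max A B"] unfolding close_def by blast
  qed
  have pow: "close (M * (1/2) ^ n)" for n
  proof (induction n)
    case (Suc n)
    from halve[OF this] show ?case by (simp add: mult_ac)
  qed (use M in simp)
  have "(\<lambda>n. M * (1/2) ^ n * exp (rate * t)) \<longlonglongrightarrow> M * 0 * exp (rate * t)"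
    by (intro tendsto_intros) auto
  then have lim: "(\<lambda>n. M * (1/2) ^ n * exp (rate * t)) \<longlonglongrightarrow> 0" by simp
  have "\<bar>E t - G t\<bar> \<le> 0"
    by (rule LIMSEQ_le_const[OF lim]) (use pow t in \<open>auto simp: close_def\<close>)
  then show "E t = G t" by simp
  assume y: "y \<in> {0..1}"
  have "\<bar>Q t y - R t y\<bar> \<le> 0"
    by (rule LIMSEQ_le_const[OF lim]) (use pow t y in \<open>auto simp: close_def\<close>)
  then show "Q t y = R t y" by simp
qed

section \<open>Global existence for the integral form\<close>

definition history :: "real \<Rightarrow> real" where
  "history s = - Qi (max 0 (min 1 (- s)))"

text \<open>
Extends a function on positive times by the history to all times; subtracting \<open>e 0\<close> makes the result
continuous at time 0 whatever \<open>e\<close> is.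
\<close>
definition past :: "(real \<Rightarrow> real) \<Rightarrow> real \<Rightarrow> real" where
  "past e s = history s + (e (max s 0) - e 0)"

text \<open>
The unknowns are the pairs \<open>(Q t y, e t)\<close>, stored as one function of \<open>(t, y)\<close> whose second component
is read at \<open>y = 0\<close>.  The new \<open>e\<close> is the solution of the condition \<open>Q t 1 = \<Phi>\<close> for \<open>E t\<close>.
\<close>
definition step_E :: "(real \<times> real \<Rightarrow> real \<times> real) \<Rightarrow> real \<Rightarrow> real" where
  "step_E f t = \<Phi> + past (\<lambda>t. snd (f (t, 0))) (t - 1) - gain (\<lambda>t y. fst (f (t, y))) t 1"

text \<open>
The increments are taken from the new \<open>e\<close>, since the old \<open>e\<close> would enter without a small factor.
\<close>
definition step_Q :: "(real \<times> real \<Rightarrow> real \<times> real) \<Rightarrow> real \<Rightarrow> real \<Rightarrow> real" where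
  "step_Q f t y = past (step_E f) t - past (step_E f) (t - y) + gain (\<lambda>t y. fst (f (t, y))) t y"

text \<open>
The arguments are clamped to the domain, so that the iteration acts on functions on the whole plane.
\<close>
definition step :: "(real \<times> real \<Rightarrow> real \<times> real) \<Rightarrow> real \<times> real \<Rightarrow> real \<times> real" where
  "step f = (\<lambda>(t, y). (step_Q f (max t 0) (max 0 (min 1 y)), step_E f (max t 0)))"

lemma history_cont: "continuous_on S history"
  unfolding history_def
  by (intro continuous_on_minus continuous_on_compose2[OF Qi_cont]) (auto intro!: continuous_intros)

lemma history_nonneg [simp]: "0 \<le> s \<Longrightarrow> history s = 0"
  by (simp add: history_def Qi_0 max_def)

lemma past_cont:
  assumes "continuous_on {0..} e"
  shows "continuous_on S (past e)"
  unfolding past_def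
  by (intro continuous_intros history_cont continuous_on_compose2[OF assms]) auto

lemma gain_at_0 [simp]: "y \<ge> 0 \<Longrightarrow> gain Q 0 y = 0"
  by (simp add: gain_def max_def)

lemma step_E_0 [simp]: "step_E f 0 = 0"
  by (simp add: step_E_def past_def history_def Qi_1)

lemma step_E_cont:
  assumes "continuous_on UNIV f"
  shows "continuous_on {0..} (step_E f)"
proof -
  have q: "continuous_on UNIV (\<lambda>(t, y). fst (f (t, y)))"
    using continuous_on_fst[OF assms] by simp
  have e: "continuous_on {0..} (\<lambda>t. snd (f (t, 0)))"
    by (intro continuous_on_snd continuous_on_compose2[OF assms]) (auto intro!: continuous_intros)
  have "continuous_on {0..} (\<lambda>t. (\<lambda>(t, y). gain (\<lambda>t y. fst (f (t, y))) t y) (t, 1))"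
    by (intro continuous_on_compose2[OF gain_cont[OF q]]) (auto intro!: continuous_intros)
  then show ?thesis
    unfolding step_E_def
    by (intro continuous_intros continuous_on_compose2[OF past_cont[OF e, of UNIV]]) auto
qed

lemma step_cont:
  assumes "continuous_on UNIV f"
  shows "continuous_on UNIV (step f)"
proof -
  have q: "continuous_on UNIV (\<lambda>(t, y). fst (f (t, y)))"
    using continuous_on_fst[OF assms] by simp
  note p = past_cont[OF step_E_cont[OF assms], of UNIV]
  have "continuous_on UNIV (\<lambda>z. (\<lambda>(t, y). gain (\<lambda>t y. fst (f (t, y))) t y)
      (max (fst z) 0, max 0 (min 1 (snd z))))"
    by (intro continuous_on_compose2[OF gain_cont[OF q]]) (auto intro!: continuous_intros)
  then show ?thesis
    unfolding step_def step_Q_def case_prod_unfold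
    by (auto intro!: continuous_intros continuous_on_compose2[OF p]
        continuous_on_compose2[OF step_E_cont[OF assms]])
qed

lemma step_zero_bounded: "\<exists>M. \<forall>z. norm (step (\<lambda>_. 0) z) \<le> M"
proof -
  obtain B where "\<forall>z\<in>Qi ` {0..1}. norm z \<le> B"
    using compact_imp_bounded[OF compact_continuous_image[OF Qi_cont compact_Icc]]
    unfolding bounded_iff by blast
  then have B: "\<And>y. y \<in> {0..1} \<Longrightarrow> \<bar>Qi y\<bar> \<le> B" by auto
  have h: "\<bar>history s\<bar> \<le> B" for s unfolding history_def using B by simp
  have g: "gain (\<lambda>t y. 0) t y = 0" for t y by (simp add: gain_def)
  have e: "\<bar>step_E (\<lambda>_. 0) t\<bar> \<le> \<bar>\<Phi>\<bar> + B" for t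
    using h[of "t - 1"] by (simp add: step_E_def past_def g)
  have p: "\<bar>past (step_E (\<lambda>_. 0)) s\<bar> \<le> B + (\<bar>\<Phi>\<bar> + B)" for s
    using h[of s] e[of "max s 0"] by (simp add: past_def)
  have q: "\<bar>step_Q (\<lambda>_. 0) t y\<bar> \<le> 2 * (B + (\<bar>\<Phi>\<bar> + B))" for t y
    using p[of t] p[of "t - y"] by (simp add: step_Q_def g)
  have "norm (step (\<lambda>_. 0) z) \<le> 2 * (B + (\<bar>\<Phi>\<bar> + B)) + (\<bar>\<Phi>\<bar> + B)" for z
  proof -
    have "norm (step (\<lambda>_. 0) z) \<le> norm (fst (step (\<lambda>_. 0) z)) + norm (snd (step (\<lambda>_. 0) z))"
      by (metis norm_Pair_le prod.collapse)
    then show ?thesis using q e unfolding step_def case_prod_unfold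
      by (smt (verit) fst_conv real_norm_def snd_conv)
  qed
  then show ?thesis by blast
qed

lemma step_contraction:
  assumes f: "continuous_on UNIV f" and g: "continuous_on UNIV g"
    and fg: "\<And>z. norm (f z - g z) \<le> M * exp (rate * max (fst z) 0)"
  shows "norm (step f z - step g z) \<le> M / 2 * exp (rate * max (fst z) 0)"
proof -
  let ?q = "\<lambda>f t y. fst (f (t, y))" and ?e = "\<lambda>f t. snd (f (t, 0))"
  have M0: "0 \<le> M" using order_trans[OF norm_ge_zero fg[of "(0, 0)"]] by simp
  have proj: "\<bar>fst z\<bar> \<le> norm z" "\<bar>snd z\<bar> \<le> norm z" for z :: "real \<times> real"
    using norm_fst_le[of "fst z" "snd z"] norm_snd_le[of "snd z" "fst z"] by simp_all
  have q: "\<bar>?q f t y - ?q g t y\<bar> \<le> M * exp (rate * t)" if "0 \<le> t" for t y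
    using fg[of "(t, y)"] proj(1)[of "f (t, y) - g (t, y)"] that by simp
  have e: "\<bar>?e f t - ?e g t\<bar> \<le> M * exp (rate * t)" if "0 \<le> t" for t
    using fg[of "(t, 0)"] proj(2)[of "f (t, 0) - g (t, 0)"] that by simp
  have cont: "continuous_on S (\<lambda>(t, y). ?q f t y)" "continuous_on S (\<lambda>(t, y). ?q g t y)" for S
    using continuous_on_fst[OF f] continuous_on_fst[OF g] by (auto elim: continuous_on_subset)
  have gn: "\<bar>gain (?q f) t y - gain (?q g) t y\<bar> \<le> M * exp (rate * t) / 48" if "0 \<le> t" "y \<in> {0..1}" for t y
    using that q by (intro gain_diff_rate cont) auto
  have E: "\<bar>step_E f t - step_E g t\<bar> \<le> M * exp (rate * t) / 16" if t: "0 \<le> t" for t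
  proof -
    have "\<bar>past (?e f) (t - 1) - past (?e g) (t - 1)\<bar> \<le> M * exp (rate * t) / 24"
    proof (cases "t \<le> 1")
      case True then show ?thesis using M0 by (simp add: past_def max_def)
    next
      case False
      then have "\<bar>past (?e f) (t - 1) - past (?e g) (t - 1)\<bar> \<le> M * exp (rate * (t - 1)) + M"
        using e[of "t - 1"] e[of 0] by (simp add: past_def)
      then show ?thesis using delay_rate[OF M0, of t] False by simp
    qed
    moreover have "\<bar>gain (?q f) t 1 - gain (?q g) t 1\<bar> \<le> M * exp (rate * t) / 48"
      using gn[OF t] by simp
    ultimately show ?thesis unfolding step_E_def by linarith
  qed
  have P: "\<bar>past (step_E f) s - past (step_E g) s\<bar> \<le> M * exp (rate * t) / 16" if "s \<le> t" "0 \<le> t" for s t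
  proof -
    have "\<bar>past (step_E f) s - past (step_E g) s\<bar> \<le> M * exp (rate * max s 0) / 16"
      using E[of "max s 0"] by (simp add: past_def)
    also have "\<dots> \<le> M * exp (rate * t) / 16"
      using M0 rate_pos that by (intro divide_right_mono mult_left_mono) auto
    finally show ?thesis .
  qed
  obtain t y where z: "z = (t, y)" by (cases z)
  define t' y' where "t' = max t 0" and "y' = max 0 (min 1 y)"
  have ty: "0 \<le> t'" "y' \<in> {0..1}" by (auto simp: t'_def y'_def)
  have "norm (step f z - step g z) \<le> \<bar>step_Q f t' y' - step_Q g t' y'\<bar> + \<bar>step_E f t' - step_E g t'\<bar>"
    using norm_Pair_le[of "step_Q f t' y' - step_Q g t' y'" "step_E f t' - step_E g t'"]
    by (simp add: step_def z t'_def y'_def)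
  also have "\<dots> \<le> M * exp (rate * t') / 2"
  proof -
    have "0 \<le> M * exp (rate * t')" using M0 by simp
    moreover have "\<bar>past (step_E f) (t' - y') - past (step_E g) (t' - y')\<bar> \<le> M * exp (rate * t') / 16"
      using ty by (intro P) auto
    ultimately show ?thesis
      using E[OF ty(1)] P[of t' t'] gn[OF ty] ty(1) unfolding step_Q_def by linarith
  qed
  finally show ?thesis by (simp add: z t'_def)
qed

lemma integral_solution_exists:
  obtains Q E where "continuous_on UNIV (\<lambda>(t, y). Q t y)" "\<And>T. integral_solution T Q E"
proof -
  obtain M where M: "\<And>z. norm (step (\<lambda>_. 0) z) \<le> M" using step_zero_bounded by blast
  have "norm (step (\<lambda>_. 0) z) \<le> M * exp (rate * max (fst z) 0)" for z
  proof -
    have "0 \<le> M" using M[of z] norm_ge_zero order_trans by blast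
    then have "M * 1 \<le> M * exp (rate * max (fst z) 0)" using rate_pos by (intro mult_left_mono) auto
    then show ?thesis using M[of z] by simp
  qed
  moreover have "continuous_on UNIV (\<lambda>z :: real \<times> real. exp (rate * max (fst z) 0))"
    by (intro continuous_intros)
  ultimately obtain f where f: "continuous_on UNIV f" and fix_f: "\<And>z. step f z = f z"
    using weighted_contraction_fixpoint[where G = step and w = "\<lambda>z. exp (rate * max (fst z) 0)" and M\<^sub>0 = M]
      step_cont step_contraction by (metis exp_gt_zero)
  define Q where "Q t y = fst (f (t, y))" for t y
  define E where "E = past (step_E f)"
  have Q_fun: "Q = (\<lambda>t y. fst (f (t, y)))" by (simp add: Q_def fun_eq_iff)
  have eqQ: "Q t y = E t - E (t - y) + gain Q t y" if "0 \<le> t" "y \<in> {0..1}" for t y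
    unfolding Q_fun using fix_f[of "(t, y)"] that by (auto simp: E_def step_def step_Q_def max_def min_def prod_eq_iff)
  have e: "snd (f (t, 0)) = step_E f t" if "0 \<le> t" for t
    using fix_f[of "(t, 0)"] that by (auto simp: step_def prod_eq_iff)
  have "E t = \<Phi> + E (t - 1) - gain Q t 1" if "0 \<le> t" for t
  proof -
    have "past (\<lambda>t. snd (f (t, 0))) (t - 1) = E (t - 1)" by (simp add: past_def E_def e)
    moreover have "E t = step_E f t" using that by (simp add: E_def past_def)
    ultimately show ?thesis by (simp add: step_E_def Q_fun)
  qed
  then have "Q t 1 = \<Phi>" if "0 \<le> t" for t using eqQ[of t 1] that by simp
  moreover have "E s = - Qi (- s)" if "s \<in> {-1..0}" for s
    using that by (cases "s = -1") (simp_all add: E_def past_def history_def)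
  moreover have Q: "continuous_on UNIV (\<lambda>(t, y). Q t y)"
    using continuous_on_fst[OF f] by (simp add: Q_def)
  moreover have "continuous_on S E" for S
    unfolding E_def by (rule past_cont[OF step_E_cont[OF f]])
  ultimately have "integral_solution T Q E" for T
    using eqQ unfolding integral_solution_def by (auto elim: continuous_on_subset)
  with Q show ?thesis using that by blast
qed

end

section \<open>Smoothness of the solution of the integral form\<close>

text \<open>
A solution of the integral form for all times, with \<open>Q\<close> extended continuously to the whole plane so
that integrands along characteristics need no domain restrictions.
\<close>
locale relaxed_solution = relaxed_problem +
  fixes Q :: "real \<Rightarrow> real \<Rightarrow> real" and E :: "real \<Rightarrow> real"
  assumes Q_cont: "continuous_on UNIV (\<lambda>(t, y). Q t y)"
    and QE: "\<And>T. integral_solution T Q E"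
begin

lemma E_hist: "s \<in> {-1..0} \<Longrightarrow> E s = - Qi (- s)"
  using QE unfolding integral_solution_def by blast

lemma Q_eq: "0 \<le> t \<Longrightarrow> y \<in> {0..1} \<Longrightarrow> Q t y = E t - E (t - y) + gain Q t y"
  using QE[of t] unfolding integral_solution_def by auto

lemma Q_1: "0 \<le> t \<Longrightarrow> Q t 1 = \<Phi>"
  using QE[of t] unfolding integral_solution_def by (metis atLeastAtMost_iff order_refl)

lemma Q_0: "0 \<le> t \<Longrightarrow> Q t 0 = 0"
  using Q_eq[of t 0] by (simp add: gain_def)

lemma Q_init: "y \<in> {0..1} \<Longrightarrow> Q 0 y = Qi y"
  using Q_eq[of 0 y] E_hist[of 0] E_hist[of "- y"] by (simp add: Qi_0)

definition drift :: "real \<Rightarrow> real \<Rightarrow> real" where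
  "drift s r = F (Q r (r - s))"

lemma gain_eq_drift: "gain Q t y = integral {max (t - y) 0..t} (drift (t - y))"
  by (simp add: gain_def drift_def[abs_def])

lemma Q_path_cont:
  assumes "continuous_on S f" "continuous_on S g"
  shows "continuous_on S (\<lambda>z. Q (f z) (g z))"
proof -
  have "continuous_on S (\<lambda>z. (\<lambda>(t, y). Q t y) (f z, g z))"
    by (rule continuous_on_compose2[OF Q_cont]) (intro continuous_intros assms, simp)
  then show ?thesis by simp
qed

lemma drift_cont2: "continuous_on UNIV (\<lambda>(s, r). drift s r)"
  unfolding drift_def case_prod_unfold
  by (intro continuous_on_compose2[OF F_cont[of UNIV]] Q_path_cont continuous_intros) auto

lemmas drift_cont = continuous_on_param_apply[OF drift_cont2]

text \<open>
The characteristic equation \<open>q' = E' + F q\<close> in integrated form, between any two times at which the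
characteristic with label \<open>s = t - y\<close> is in the domain.
\<close>
lemma along_path:
  assumes "-1 \<le> s" "max s 0 \<le> r" "r \<le> t" "t \<le> s + 1"
  shows "Q t (t - s) = Q r (r - s) + (E t - E r) + integral {r..t} (drift s)"
proof -
  have "Q t (t - s) = E t - E s + integral {max s 0..t} (drift s)"
    using Q_eq[of t "t - s"] assms by (simp add: gain_eq_drift)
  moreover have "Q r (r - s) = E r - E s + integral {max s 0..r} (drift s)"
    using Q_eq[of r "r - s"] assms by (simp add: gain_eq_drift)
  moreover have "integral {max s 0..r} (drift s) + integral {r..t} (drift s) = integral {max s 0..t} (drift s)"
    using assms by (intro Henstock_Kurzweil_Integration.integral_combine integrable_continuous_real drift_cont)
  ultimately show ?thesis by simp
qed

text \<open>
The divided difference of \<open>K\<close> between the values of \<open>Q\<close> on two characteristics at time \<open>r\<close>; when the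
characteristics coincide it is \<open>K' (Q r (r - s))\<close>.
\<close>
definition slope :: "real \<times> real \<Rightarrow> real \<Rightarrow> real" where
  "slope = (\<lambda>(s\<^sub>1, s\<^sub>2) r. average K' (Q r (r - s\<^sub>2)) (Q r (r - s\<^sub>1)))"

lemma slope_cont2: "continuous_on UNIV (\<lambda>(p, r). slope p r)"
proof -
  have *: "continuous_on UNIV (\<lambda>(x :: (real \<times> real) \<times> real, r). K' r)"
    unfolding case_prod_unfold by (rule continuous_on_compose2[OF K'_cont]) (auto intro!: continuous_intros)
  have "continuous_on UNIV (\<lambda>z :: (real \<times> real) \<times> real. average K'
      (Q (snd z) (snd z - snd (fst z))) (Q (snd z) (snd z - fst (fst z))))"
    by (rule continuous_on_average[OF *]) (intro Q_path_cont continuous_intros)+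
  then show ?thesis by (simp add: slope_def case_prod_unfold)
qed

lemmas slope_cont = continuous_on_param_apply[OF slope_cont2]

lemma drift_diff: "drift s\<^sub>1 r - drift s\<^sub>2 r = slope (s\<^sub>1, s\<^sub>2) r * (Q r (r - s\<^sub>1) - Q r (r - s\<^sub>2))"
  unfolding drift_def slope_def using increment_eq_average[of F K' "Q r (r - s\<^sub>1)" "Q r (r - s\<^sub>2)"] F_deriv by simp

text \<open>
Once both characteristics have entered the domain, the terms with \<open>E\<close> cancel in the difference of
their equations, and what remains is the linear equation with coefficient \<open>slope\<close>.  The first factor
is the difference at the later of the two entry times.
\<close>
lemma path_increment:
  assumes "-1 \<le> s\<^sub>1" "s\<^sub>1 \<le> s\<^sub>2" "max s\<^sub>2 0 \<le> t" "t \<le> s\<^sub>1 + 1"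
  shows "Q t (t - s\<^sub>1) - Q t (t - s\<^sub>2) =
    (E s\<^sub>2 - E s\<^sub>1 + integral {max s\<^sub>1 0..max s\<^sub>2 0} (drift s\<^sub>1)) * exp (integral {max s\<^sub>2 0..t} (slope (s\<^sub>1, s\<^sub>2)))"
proof -
  let ?a = "max s\<^sub>2 0"
  define D where "D r = Q r (r - s\<^sub>1) - Q r (r - s\<^sub>2)" for r
  have D_eq: "D r = D ?a + (integral {?a..r} (drift s\<^sub>1) - integral {?a..r} (drift s\<^sub>2))" if "r \<in> {?a..t}" for r
    using along_path[of s\<^sub>1 ?a r] along_path[of s\<^sub>2 ?a r] assms that by (simp add: D_def)
  have "D t = D ?a * exp (integral {?a..t} (slope (s\<^sub>1, s\<^sub>2)))"
  proof (rule linear_ode_solution)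
    fix r assume r: "r \<in> {?a..t}"
    have "((\<lambda>r. D ?a + (integral {?a..r} (drift s\<^sub>1) - integral {?a..r} (drift s\<^sub>2))) has_real_derivative
        slope (s\<^sub>1, s\<^sub>2) r * D r) (at r within {?a..t})"
      by (rule derivative_eq_intros integral_has_real_derivative drift_cont r refl)+
         (simp add: drift_diff D_def)
    then show "(D has_real_derivative slope (s\<^sub>1, s\<^sub>2) r * D r) (at r within {?a..t})"
      by (rule has_field_derivative_transform_within[OF _ zero_less_one r]) (metis D_eq)
  qed (use assms slope_cont in auto)
  moreover have "D ?a = E s\<^sub>2 - E s\<^sub>1 + integral {max s\<^sub>1 0..?a} (drift s\<^sub>1)"
    using Q_eq[of ?a "?a - s\<^sub>1"] Q_eq[of ?a "?a - s\<^sub>2"] assms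
    by (simp add: D_def gain_eq_drift)
  ultimately show ?thesis by (simp add: D_def)
qed

text \<open>
The exponential of the integral of \<open>K' Q\<close> along the characteristic through \<open>(t, y)\<close>: the limit of
the exponential factor in the increment formula as the two characteristics merge.
\<close>
definition stretch :: "real \<Rightarrow> real \<Rightarrow> real" where
  "stretch t y = exp (integral {max (t - y) 0..t} (slope (t - y, t - y)))"

lemma stretch_cont: "continuous_on ({0..} \<times> {0..1}) (\<lambda>(t, y). stretch t y)"
proof -
  have "continuous_on UNIV (\<lambda>(p, r). slope (fst p - snd p, fst p - snd p) r)"
  proof -
    have "continuous_on UNIV (\<lambda>z. (\<lambda>(p, r). slope p r)
        ((fst (fst z) - snd (fst z), fst (fst z) - snd (fst z)), snd z))"
      by (rule continuous_on_compose2[OF slope_cont2]) (auto intro!: continuous_intros)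
    then show ?thesis by (simp add: case_prod_unfold)
  qed
  then have "continuous_on ({0..} \<times> {0..1}) (\<lambda>p. integral {max (fst p - snd p) 0..fst p}
      (slope (fst p - snd p, fst p - snd p)))"
    by (rule continuous_on_integral_param) (auto intro!: continuous_intros)
  then show ?thesis
    unfolding stretch_def case_prod_unfold by (intro continuous_intros)
qed

text \<open>
The quotient of the increment formula in the limit of merging characteristics.  The integral of
\<open>drift\<close> between the two entry times is negligible: for \<open>t < y\<close> both entry times are 0, and otherwise
its integrand is close to the value \<open>F (Q s 0) = F 0 = 0\<close> on the boundary.  Time and both
space points may move, which is needed for the derivatives of \<open>E\<close> and of \<open>Q\<close> in time.
\<close>
lemma increment_quotient:
  fixes \<tau> y\<^sub>1 y\<^sub>2 :: "'z \<Rightarrow> real"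
  assumes \<tau>: "(\<tau> \<longlongrightarrow> t) G" and y1: "(y\<^sub>1 \<longlongrightarrow> y) G" and y2: "(y\<^sub>2 \<longlongrightarrow> y) G"
    and t: "0 \<le> t" and y: "y \<in> {0..1}"
    and ev: "\<forall>\<^sub>F z in G. 0 \<le> \<tau> z \<and> 0 \<le> y\<^sub>2 z \<and> y\<^sub>2 z < y\<^sub>1 z \<and> y\<^sub>1 z \<le> 1"
    and E': "((\<lambda>z. (E (\<tau> z - y\<^sub>2 z) - E (\<tau> z - y\<^sub>1 z)) / (y\<^sub>1 z - y\<^sub>2 z)) \<longlongrightarrow> d) G"
  shows "((\<lambda>z. (Q (\<tau> z) (y\<^sub>1 z) - Q (\<tau> z) (y\<^sub>2 z)) / (y\<^sub>1 z - y\<^sub>2 z)) \<longlongrightarrow> d * stretch t y) G"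
proof -
  let ?s1 = "\<lambda>z. \<tau> z - y\<^sub>1 z" and ?s2 = "\<lambda>z. \<tau> z - y\<^sub>2 z"
  have s1: "(?s1 \<longlongrightarrow> t - y) G" and s2: "(?s2 \<longlongrightarrow> t - y) G"
    by (intro tendsto_intros \<tau> y1 y2)+
  define \<psi> where "\<psi> z = integral {max (?s1 z) 0..max (?s2 z) 0} (drift (?s1 z)) / (y\<^sub>1 z - y\<^sub>2 z)" for z
  have \<psi>: "(\<psi> \<longlongrightarrow> 0) G"
  proof (cases "t < y")
    case True
    have "\<forall>\<^sub>F z in G. ?s1 z < 0 \<and> ?s2 z < 0"
      using order_tendstoD(2)[OF s1, of 0] order_tendstoD(2)[OF s2, of 0] True by (simp add: eventually_conj)
    then have "\<forall>\<^sub>F z in G. 0 = \<psi> z" by eventually_elim (simp add: \<psi>_def max_def)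
    then show ?thesis by (rule Lim_transform_eventually[OF tendsto_const])
  next
    case False
    have max: "((\<lambda>z. max (?s1 z) 0) \<longlongrightarrow> t - y) G" "((\<lambda>z. max (?s2 z) 0) \<longlongrightarrow> t - y) G"
      using tendsto_max[OF s1 tendsto_const[of 0]] tendsto_max[OF s2 tendsto_const[of 0]] False by (simp_all add: max_absorb1)
    have "drift (t - y) (t - y) = 0" using False by (simp add: drift_def Q_0)
    with tendsto_average[OF drift_cont2 s1 max]
    have A: "((\<lambda>z. average (drift (?s1 z)) (max (?s1 z) 0) (max (?s2 z) 0)) \<longlongrightarrow> 0) G" by simp
    show ?thesis
    proof (rule Lim_null_comparison[OF _ tendsto_rabs_zero[OF A]])
      show "\<forall>\<^sub>F z in G. norm (\<psi> z) \<le> \<bar>average (drift (?s1 z)) (max (?s1 z) 0) (max (?s2 z) 0)\<bar>"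
        using ev
      proof eventually_elim
        case (elim z)
        let ?A = "average (drift (?s1 z)) (max (?s1 z) 0) (max (?s2 z) 0)"
        have "integral {max (?s1 z) 0..max (?s2 z) 0} (drift (?s1 z)) = (max (?s2 z) 0 - max (?s1 z) 0) * ?A"
          using elim by (intro integral_eq_average drift_cont) auto
        moreover have len: "\<bar>max (?s2 z) 0 - max (?s1 z) 0\<bar> \<le> y\<^sub>1 z - y\<^sub>2 z"
          using elim by auto
        ultimately have "\<bar>integral {max (?s1 z) 0..max (?s2 z) 0} (drift (?s1 z))\<bar> \<le> (y\<^sub>1 z - y\<^sub>2 z) * \<bar>?A\<bar>"
          using mult_right_mono[OF len abs_ge_zero[of ?A]] by (simp add: abs_mult)
        then show ?case using elim by (simp add: \<psi>_def field_simps)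
      qed
    qed
  qed
  have J: "((\<lambda>z. integral {max (?s2 z) 0..\<tau> z} (slope (?s1 z, ?s2 z)))
      \<longlongrightarrow> integral {max (t - y) 0..t} (slope (t - y, t - y))) G"
  proof -
    let ?S = "{p :: real \<times> real \<times> real. max (snd (snd p)) 0 \<le> fst p}"
    have "continuous_on UNIV (\<lambda>(p :: real \<times> real \<times> real, r). slope (snd p) r)"
    proof -
      have "continuous_on UNIV (\<lambda>z :: (real \<times> real \<times> real) \<times> real. (\<lambda>(p, r). slope p r) (snd (fst z), snd z))"
        by (rule continuous_on_compose2[OF slope_cont2]) (auto intro!: continuous_intros)
      then show ?thesis by (simp add: case_prod_unfold)
    qed
    then have c: "continuous_on ?S (\<lambda>p. integral {max (snd (snd p)) 0..fst p} (slope (snd p)))"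
      by (rule continuous_on_integral_param) (auto intro!: continuous_intros)
    have "((\<lambda>z. (\<tau> z, ?s1 z, ?s2 z)) \<longlongrightarrow> (t, t - y, t - y)) G"
      by (intro tendsto_Pair \<tau> s1 s2)
    moreover have "\<forall>\<^sub>F z in G. (\<tau> z, ?s1 z, ?s2 z) \<in> ?S" using ev by eventually_elim auto
    ultimately show ?thesis
      using continuous_on_tendsto_compose[OF c, of "\<lambda>z. (\<tau> z, ?s1 z, ?s2 z)" "(t, t - y, t - y)" G] t y by simp
  qed
  have "((\<lambda>z. ((E (?s2 z) - E (?s1 z)) / (y\<^sub>1 z - y\<^sub>2 z) + \<psi> z) *
      exp (integral {max (?s2 z) 0..\<tau> z} (slope (?s1 z, ?s2 z)))) \<longlongrightarrow> (d + 0) * stretch t y) G"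
    unfolding stretch_def by (intro tendsto_intros E' \<psi> J)
  moreover have "\<forall>\<^sub>F z in G. ((E (?s2 z) - E (?s1 z)) / (y\<^sub>1 z - y\<^sub>2 z) + \<psi> z) *
      exp (integral {max (?s2 z) 0..\<tau> z} (slope (?s1 z, ?s2 z))) =
      (Q (\<tau> z) (y\<^sub>1 z) - Q (\<tau> z) (y\<^sub>2 z)) / (y\<^sub>1 z - y\<^sub>2 z)"
    using ev
  proof eventually_elim
    case (elim z)
    then show ?case
      using path_increment[of "?s1 z" "?s2 z" "\<tau> z"] by (simp add: \<psi>_def flip: add_divide_distrib)
  qed
  ultimately show ?thesis by (simp add: Lim_transform_eventually)
qed


text \<open>
Since \<open>Q\<close> equals \<open>\<Phi>\<close> on the line \<open>y = 1\<close> at both times \<open>lo < hi\<close>, following the characteristic that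
arrives at \<open>(hi, 1)\<close> back to time \<open>lo\<close> expresses \<open>E hi - E lo\<close> by a space increment of \<open>Q\<close> at the
time \<open>lo\<close>.  That increment involves only values of \<open>E\<close> one unit of time earlier.
\<close>
lemma E_derivative_step:
  assumes E': "\<And>s. s \<in> {-1..b} \<Longrightarrow> (E has_real_derivative g s) (at s within {-1..b})"
    and g: "continuous_on {-1..b} g" and t: "t \<in> {0..b + 1}"
  shows "(E has_real_derivative g (t - 1) * stretch t 1 - K \<Phi> + K 0) (at t within {0..b + 1})"
  unfolding derivative_iff_min_max_quotient
proof -
  let ?G = "at t within {0..b + 1}"
  let ?lo = "\<lambda>x. min x t" and ?hi = "\<lambda>x. max x t"
  let ?h = "\<lambda>x. ?hi x - ?lo x"
  note lim = tendsto_min_max_id[of t "{0..b + 1}"]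
  have ev: "\<forall>\<^sub>F x in ?G. 0 \<le> ?lo x \<and> ?lo x < ?hi x \<and> ?hi x \<le> b + 1 \<and> ?h x < 1"
  proof -
    have "(?h \<longlongrightarrow> t - t) ?G" by (intro tendsto_intros lim)
    then have "\<forall>\<^sub>F x in ?G. ?h x < 1" by (rule order_tendstoD) simp
    moreover have "\<forall>\<^sub>F x in ?G. x \<in> {0..b + 1} \<and> x \<noteq> t"
      by (simp add: eventually_at_filter)
    ultimately show ?thesis by eventually_elim (use t in auto)
  qed
  have "((\<lambda>x. (E (?lo x - (1 - ?h x)) - E (?lo x - 1)) / (1 - (1 - ?h x))) \<longlongrightarrow> g (t - 1)) ?G"
  proof -
    have 1: "((\<lambda>x. ?lo x - 1) \<longlongrightarrow> t - 1) ?G" "((\<lambda>x. ?lo x - (1 - ?h x)) \<longlongrightarrow> t - (1 - (t - t))) ?G"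
      by (intro tendsto_intros lim)+
    have "((\<lambda>x. (E (?lo x - (1 - ?h x)) - E (?lo x - 1)) / ((?lo x - (1 - ?h x)) - (?lo x - 1))) \<longlongrightarrow> g (t - 1)) ?G"
    proof (rule strict_difference_quotient[OF E' g 1(1)])
      show "((\<lambda>x. ?lo x - (1 - ?h x)) \<longlongrightarrow> t - 1) ?G" using 1(2) by simp
      show "\<forall>\<^sub>F x in ?G. -1 \<le> ?lo x - 1 \<and> ?lo x - 1 < ?lo x - (1 - ?h x) \<and> ?lo x - (1 - ?h x) \<le> b"
        using ev by eventually_elim auto
    qed (use t in auto)
    then show ?thesis by simp
  qed
  then have "((\<lambda>x. (Q (?lo x) 1 - Q (?lo x) (1 - ?h x)) / (1 - (1 - ?h x))) \<longlongrightarrow> g (t - 1) * stretch t 1) ?G"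
  proof (rule increment_quotient[rotated -1])
    have "((\<lambda>x. 1 - ?h x) \<longlongrightarrow> 1 - (t - t)) ?G" by (intro tendsto_intros lim)
    then show "((\<lambda>x. 1 - ?h x) \<longlongrightarrow> 1) ?G" by simp
    show "\<forall>\<^sub>F x in ?G. 0 \<le> ?lo x \<and> 0 \<le> 1 - ?h x \<and> 1 - ?h x < 1 \<and> (1::real) \<le> 1"
      using ev by eventually_elim auto
  qed (use t lim in auto)
  moreover have "((\<lambda>x. average (drift (?hi x - 1)) (?lo x) (?hi x)) \<longlongrightarrow> drift (t - 1) t) ?G"
    by (rule tendsto_average[OF drift_cont2]) (intro tendsto_intros lim)+
  ultimately have "((\<lambda>x. (Q (?lo x) 1 - Q (?lo x) (1 - ?h x)) / (1 - (1 - ?h x)) - average (drift (?hi x - 1)) (?lo x) (?hi x))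
      \<longlongrightarrow> g (t - 1) * stretch t 1 - drift (t - 1) t) ?G"
    by (rule tendsto_diff)
  moreover have "\<forall>\<^sub>F x in ?G. (Q (?lo x) 1 - Q (?lo x) (1 - ?h x)) / (1 - (1 - ?h x)) - average (drift (?hi x - 1)) (?lo x) (?hi x)
      = (E (?hi x) - E (?lo x)) / ?h x"
    using ev
  proof eventually_elim
    case (elim x)
    have "Q (?hi x) 1 = Q (?lo x) (1 - ?h x) + (E (?hi x) - E (?lo x)) + integral {?lo x..?hi x} (drift (?hi x - 1))"
    proof -
      have "max (?hi x - 1) 0 \<le> ?lo x" using elim by linarith
      moreover have "?lo x - (?hi x - 1) = 1 - ?h x" "?hi x - (?hi x - 1) = 1" by simp_all
      ultimately show ?thesis
        using along_path[of "?hi x - 1" "?lo x" "?hi x"] elim by (metis diff_add_cancel diff_ge_0_iff_ge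
            diff_minus_eq_add less_imp_le order_refl order_trans)
    qed
    moreover have "Q (?hi x) 1 = Q (?lo x) 1" using Q_1[of "?hi x"] Q_1[of "?lo x"] elim by linarith
    moreover have "integral {?lo x..?hi x} (drift (?hi x - 1)) = ?h x * average (drift (?hi x - 1)) (?lo x) (?hi x)"
      using elim by (intro integral_eq_average drift_cont) simp
    ultimately have "E (?hi x) - E (?lo x) = Q (?lo x) 1 - Q (?lo x) (1 - ?h x) - ?h x * average (drift (?hi x - 1)) (?lo x) (?hi x)"
      by simp
    moreover have "?h x \<noteq> 0" using elim by simp
    ultimately show ?case by (simp add: diff_divide_distrib)
  qed
  moreover have "drift (t - 1) t = K \<Phi> - K 0" using t by (simp add: drift_def Q_1 F_def)
  ultimately have "((\<lambda>x. (E (?hi x) - E (?lo x)) / ?h x) \<longlongrightarrow> g (t - 1) * stretch t 1 - (K \<Phi> - K 0)) ?G"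
    by (simp only: Lim_transform_eventually)
  then show "((\<lambda>x. (E (?hi x) - E (?lo x)) / ?h x) \<longlongrightarrow> g (t - 1) * stretch t 1 - K \<Phi> + K 0) ?G"
    by (simp only: diff_diff_eq2 diff_add_eq)
qed

lemma stretch_at_0: "y \<in> {0..1} \<Longrightarrow> stretch 0 y = 1"
  by (simp add: stretch_def max_def)

lemma E_hist_derivative:
  assumes "s \<in> {-1..0}"
  shows "(E has_real_derivative Qi' (- s)) (at s within {-1..0})"
proof -
  have "uminus ` {-1..0::real} = {0..1}" by simp
  then have "(Qi has_real_derivative Qi' (- s)) (at (- s) within uminus ` {-1..0})"
    using Qi_deriv[of "- s"] assms by simp
  then have "(Qi \<circ> uminus has_real_derivative Qi' (- s) * - 1) (at s within {-1..0})"
    by (rule DERIV_image_chain) (rule DERIV_minus[OF DERIV_ident])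
  from DERIV_minus[OF this] have "((\<lambda>s. - Qi (- s)) has_real_derivative Qi' (- s)) (at s within {-1..0})"
    by (simp add: o_def)
  then show ?thesis
    by (rule has_field_derivative_transform_within[OF _ zero_less_one assms]) (simp add: E_hist)
qed

text \<open>
Induction over unit time steps.  The derivative from the history and the one from the delay formula
have to match at time 0; there they are \<open>Qi' 0\<close> and \<open>Qi' 1 - K \<Phi> + K 0\<close>.
\<close>
lemma E_C1_up_to:
  "\<exists>g. continuous_on {-1..real n} g \<and> (\<forall>s\<in>{-1..0}. g s = Qi' (- s)) \<and>
    (\<forall>s\<in>{-1..real n}. (E has_real_derivative g s) (at s within {-1..real n}))"
proof (induction n)
  case 0
  have "continuous_on {-1..0} (\<lambda>s. Qi' (- s))"
    by (rule continuous_on_compose2[OF Qi'_cont]) (auto intro!: continuous_intros)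
  then show ?case by (intro exI[of _ "\<lambda>s. Qi' (- s)"]) (simp add: E_hist_derivative)
next
  case (Suc n)
  then obtain g where g: "continuous_on {-1..real n} g" "\<And>s. s \<in> {-1..0} \<Longrightarrow> g s = Qi' (- s)"
    and E': "\<And>s. s \<in> {-1..real n} \<Longrightarrow> (E has_real_derivative g s) (at s within {-1..real n})" by blast
  define h where "h t = g (t - 1) * stretch t 1 - K \<Phi> + K 0" for t
  define g' where "g' s = (if s \<le> 0 then Qi' (- s) else h s)" for s
  have h0: "h 0 = Qi' 0" using g(2)[of "-1"] compat by (simp add: h_def stretch_at_0)
  have g'_h: "g' s = h s" if "0 \<le> s" for s using that h0 by (auto simp: g'_def)
  have un: "{-1..real (Suc n)} = {-1..0} \<union> {0..real n + 1}" by auto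
  have c0: "continuous_on {-1..0} g'"
  proof -
    have "continuous_on {-1..0} (\<lambda>s. Qi' (- s))"
      by (rule continuous_on_compose2[OF Qi'_cont]) (auto intro!: continuous_intros)
    then show ?thesis by (rule continuous_on_eq) (simp add: g'_def)
  qed
  have c1: "continuous_on {0..real n + 1} g'"
  proof -
    have "continuous_on {0..real n + 1} (\<lambda>t. (\<lambda>(t, y). stretch t y) (t, 1))"
      by (rule continuous_on_compose2[OF stretch_cont]) (auto intro!: continuous_intros)
    then have "continuous_on {0..real n + 1} h"
      unfolding h_def by (intro continuous_intros continuous_on_compose2[OF g(1)]) auto
    then show ?thesis by (rule continuous_on_eq) (simp add: g'_h)
  qed
  have "continuous_on {-1..real (Suc n)} g'"
    unfolding un by (rule continuous_on_closed_Un[OF _ _ c0 c1]) auto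
  moreover have "(E has_real_derivative g' s) (at s within {-1..real (Suc n)})" if "s \<in> {-1..real (Suc n)}" for s
    unfolding un
  proof (rule has_real_derivative_Un)
    show "s \<in> {-1..0} \<union> {0..real n + 1}" using that un by blast
    show "(E has_real_derivative g' s) (at s within {-1..0})" if "s \<in> {-1..0}"
      using E_hist_derivative[OF that] that by (simp add: g'_def)
    show "(E has_real_derivative g' s) (at s within {0..real n + 1})" if "s \<in> {0..real n + 1}"
      using E_derivative_step[OF E' g(1) that] that by (simp add: g'_h h_def)
  qed auto
  ultimately show ?case by (intro exI[of _ g']) (simp add: g'_def)
qed

text \<open>
The derivatives of \<open>E\<close> on the growing intervals \<open>[-1, n]\<close> come from separate existence statements;
they all agree with the derivative on the half-line, which is unique.
\<close>
definition dE :: "real \<Rightarrow> real" where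
  "dE s = (SOME d. (E has_real_derivative d) (at s within {-1..}))"

lemma dE_local:
  assumes g: "\<And>s. s \<in> {-1..real n} \<Longrightarrow> (E has_real_derivative g s) (at s within {-1..real n})"
    and s: "-1 \<le> s" "s < real n"
  shows "(E has_real_derivative dE s) (at s within {-1..})" and "dE s = g s"
proof -
  have "at s within {-1..real n} = at s within {-1..}"
    by (rule at_within_nhd[of s "{..<real n}"]) (use s in auto)
  then have *: "(E has_real_derivative g s) (at s within {-1..})" using g[of s] s by simp
  then show **: "(E has_real_derivative dE s) (at s within {-1..})"
    unfolding dE_def by (rule someI)
  show "dE s = g s"
    by (rule real_derivative_unique_Icc[OF _ _ _ ** *, of s "s + 1"]) (use s in auto)
qed

lemma E_deriv: "-1 \<le> s \<Longrightarrow> (E has_real_derivative dE s) (at s within {-1..})"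
proof -
  assume s: "-1 \<le> s"
  obtain n where n: "s < real n" using reals_Archimedean2 by blast
  obtain g where "\<forall>s\<in>{-1..real n}. (E has_real_derivative g s) (at s within {-1..real n})"
    using E_C1_up_to by blast
  then show ?thesis using dE_local(1)[of n g s] s n by blast
qed

lemma dE_hist: "s \<in> {-1..0} \<Longrightarrow> dE s = Qi' (- s)"
  using E_C1_up_to[of 1] dE_local(2)[of 1 _ s] by force

lemma dE_cont: "continuous_on {-1..} dE"
  unfolding continuous_on_eq_continuous_within
proof
  fix s :: real assume s: "s \<in> {-1..}"
  obtain n where n: "s < real n" using reals_Archimedean2 by blast
  obtain g where g: "continuous_on {-1..real n} g"
    "\<And>s. s \<in> {-1..real n} \<Longrightarrow> (E has_real_derivative g s) (at s within {-1..real n})"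
    using E_C1_up_to by blast
  have "continuous_on {-1..<real n} dE"
    using continuous_on_subset[OF g(1), of "{-1..<real n}"]
    by (rule continuous_on_eq) (use dE_local(2)[OF g(2)] in auto)
  then have "continuous (at s within {-1..<real n}) dE"
    using s n by (simp add: continuous_on_eq_continuous_within)
  moreover have "at s within {-1..<real n} = at s within {-1..}"
    by (rule at_within_nhd[of s "{..<real n}"]) (use n in auto)
  ultimately show "continuous (at s within {-1..}) dE" by simp
qed

lemma E_deriv_Icc: "s \<in> {-1..b} \<Longrightarrow> (E has_real_derivative dE s) (at s within {-1..b})"
  using E_deriv by (rule has_field_derivative_subset) auto

lemma dE_cont_Icc: "continuous_on {-1..b} dE"
  using dE_cont by (rule continuous_on_subset) auto

lemma dE_delay:
  assumes "0 \<le> t"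
  shows "dE t = dE (t - 1) * stretch t 1 - K \<Phi> + K 0"
proof (rule real_derivative_unique_Icc[of 0 "t + 1" t "{0..t + 1}" E])
  show "(E has_real_derivative dE (t - 1) * stretch t 1 - K \<Phi> + K 0) (at t within {0..t + 1})"
    by (rule E_derivative_step[OF E_deriv_Icc dE_cont_Icc]) (use assms in auto)
  show "(E has_real_derivative dE t) (at t within {0..t + 1})"
    by (rule has_field_derivative_subset[OF E_deriv]) (use assms in auto)
qed (use assms in auto)

text \<open>
The derivative of \<open>Q t\<close> at \<open>y\<close>: the slope \<open>E'\<close> with which the characteristic through \<open>(t, y)\<close> entered
the domain, stretched by the linearised flow.
\<close>
definition V :: "real \<Rightarrow> real \<Rightarrow> real" where
  "V t y = dE (t - y) * stretch t y"

text \<open>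
The relaxed counterpart of \<open>1 / N\<close>, of either sign.
\<close>
definition invN :: "real \<Rightarrow> real" where
  "invN t = dE t - K 0"

lemma V_cont: "continuous_on ({0..} \<times> {0..1}) (\<lambda>(t, y). V t y)"
proof -
  have "continuous_on ({0..} \<times> {0..1}) (\<lambda>z. dE (fst z - snd z) * (\<lambda>(t, y). stretch t y) z)"
    by (intro continuous_on_mult stretch_cont continuous_on_compose2[OF dE_cont])
       (auto intro!: continuous_intros)
  then show ?thesis by (simp add: V_def case_prod_unfold)
qed

lemma invN_cont: "continuous_on {0..} invN"
  unfolding invN_def by (intro continuous_intros continuous_on_subset[OF dE_cont]) auto

lemma invN_eq: "0 \<le> t \<Longrightarrow> invN t = V t 1 - K \<Phi>"
  by (simp add: invN_def V_def dE_delay)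

lemma Q_deriv_y:
  assumes t: "0 \<le> t" and y: "y \<in> {0..1}"
  shows "(Q t has_real_derivative V t y) (at y within {0..1})"
  unfolding derivative_iff_min_max_quotient V_def
proof (rule increment_quotient[of "\<lambda>_. t"])
  let ?G = "at y within {0..1}"
  note lim = tendsto_min_max_id[of y "{0..1}"]
  show ev: "\<forall>\<^sub>F x in ?G. 0 \<le> t \<and> 0 \<le> min x y \<and> min x y < max x y \<and> max x y \<le> 1"
  proof -
    have "\<forall>\<^sub>F x in ?G. x \<in> {0..1} \<and> x \<noteq> y" by (simp add: eventually_at_filter)
    then show ?thesis by eventually_elim (use t y in auto)
  qed
  have 1: "((\<lambda>x. t - max x y) \<longlongrightarrow> t - y) ?G" "((\<lambda>x. t - min x y) \<longlongrightarrow> t - y) ?G"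
    by (intro tendsto_intros lim)+
  have "((\<lambda>x. (E (t - min x y) - E (t - max x y)) / ((t - min x y) - (t - max x y))) \<longlongrightarrow> dE (t - y)) ?G"
  proof (rule strict_difference_quotient[OF E_deriv_Icc dE_cont_Icc 1, of t])
    show "\<forall>\<^sub>F x in ?G. -1 \<le> t - max x y \<and> t - max x y < t - min x y \<and> t - min x y \<le> t"
      using ev by eventually_elim (use t in linarith)
  qed (use t y in auto)
  then show "((\<lambda>x. (E (t - min x y) - E (t - max x y)) / (max x y - min x y)) \<longlongrightarrow> dE (t - y)) ?G"
    by simp
qed (use tendsto_min_max_id t y in auto)

text \<open>
For \<open>y < 1\<close> follow the characteristic from \<open>(lo, y)\<close> to \<open>(hi, y + h)\<close> with \<open>h = hi - lo\<close>, and return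
to \<open>(hi, y)\<close> by a space increment.  On the line \<open>y = 1\<close>, where the characteristic would leave the
domain, \<open>Q\<close> is constant, and the formula says that \<open>invN + K \<Phi>\<close> is the slope there.
\<close>
lemma Q_deriv_t:
  assumes t: "0 \<le> t" and y: "y \<in> {0..1}"
  shows "((\<lambda>s. Q s y) has_real_derivative invN t + K (Q t y) - V t y) (at t within {0..})"
proof (cases "y = 1")
  case True
  have "((\<lambda>s. \<Phi>) has_real_derivative invN t + K (Q t y) - V t y) (at t within {0..})"
    using t True by (simp add: invN_eq Q_1)
  then show ?thesis
    by (rule has_field_derivative_transform_within[OF _ zero_less_one]) (use t True in \<open>simp_all add: Q_1\<close>)
next
  case False
  then have y1: "0 \<le> y" "y < 1" using y by auto
  show ?thesis
    unfolding derivative_iff_min_max_quotient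
  proof -
    let ?G = "at t within {0..}"
    let ?lo = "\<lambda>x. min x t" and ?hi = "\<lambda>x. max x t"
    let ?h = "\<lambda>x. ?hi x - ?lo x"
    note lim = tendsto_min_max_id[of t "{0..}"]
    have ev: "\<forall>\<^sub>F x in ?G. 0 \<le> ?lo x \<and> ?lo x < ?hi x \<and> ?hi x \<le> t + 1 \<and> y + ?h x \<le> 1"
    proof -
      have "(?h \<longlongrightarrow> t - t) ?G" by (intro tendsto_intros lim)
      then have "\<forall>\<^sub>F x in ?G. ?h x < 1 - y" by (rule order_tendstoD) (use y1 in simp)
      moreover have "\<forall>\<^sub>F x in ?G. x \<in> {0..} \<and> x \<noteq> t"
        by (simp add: eventually_at_filter)
      ultimately show ?thesis by eventually_elim (use t y1 in auto)
    qed
    have 1: "((\<lambda>x. ?lo x - y) \<longlongrightarrow> t - y) ?G" "((\<lambda>x. ?hi x - y) \<longlongrightarrow> t - y) ?G"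
      by (intro tendsto_intros lim)+
    have "((\<lambda>x. (E (?hi x - y) - E (?lo x - y)) / ((?hi x - y) - (?lo x - y))) \<longlongrightarrow> dE (t - y)) ?G"
    proof (rule strict_difference_quotient[OF E_deriv_Icc dE_cont_Icc 1, of "t + 1"])
      show "\<forall>\<^sub>F x in ?G. -1 \<le> ?lo x - y \<and> ?lo x - y < ?hi x - y \<and> ?hi x - y \<le> t + 1"
        using ev by eventually_elim (use y1 in linarith)
    qed (use t y1 in auto)
    then have "((\<lambda>x. (E (?hi x - y) - E (?hi x - (y + ?h x))) / ((y + ?h x) - y)) \<longlongrightarrow> dE (t - y)) ?G"
      by simp
    then have "((\<lambda>x. (Q (?hi x) (y + ?h x) - Q (?hi x) y) / ((y + ?h x) - y)) \<longlongrightarrow> V t y) ?G"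
      unfolding V_def
    proof (rule increment_quotient[rotated -1])
      have "((\<lambda>x. y + ?h x) \<longlongrightarrow> y + (t - t)) ?G" by (intro tendsto_intros lim)
      then show "((\<lambda>x. y + ?h x) \<longlongrightarrow> y) ?G" by simp
      show "\<forall>\<^sub>F x in ?G. 0 \<le> ?hi x \<and> 0 \<le> y \<and> y < y + ?h x \<and> y + ?h x \<le> 1"
        using ev by eventually_elim (use y1 in linarith)
    qed (use t y lim in auto)
    moreover have "((\<lambda>x. average (drift (?lo x - y)) (?lo x) (?hi x)) \<longlongrightarrow> drift (t - y) t) ?G"
      by (rule tendsto_average[OF drift_cont2 1(1)]) (intro lim)+
    moreover have "((\<lambda>x. (E (?hi x) - E (?lo x)) / ?h x) \<longlongrightarrow> dE t) ?G"
      unfolding derivative_iff_min_max_quotient[symmetric]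
      by (rule has_field_derivative_subset[OF E_deriv]) (use t in auto)
    ultimately have "((\<lambda>x. (E (?hi x) - E (?lo x)) / ?h x + average (drift (?lo x - y)) (?lo x) (?hi x)
        - (Q (?hi x) (y + ?h x) - Q (?hi x) y) / ((y + ?h x) - y)) \<longlongrightarrow> dE t + drift (t - y) t - V t y) ?G"
      by (intro tendsto_add tendsto_diff)
    moreover have "\<forall>\<^sub>F x in ?G. (E (?hi x) - E (?lo x)) / ?h x + average (drift (?lo x - y)) (?lo x) (?hi x)
        - (Q (?hi x) (y + ?h x) - Q (?hi x) y) / ((y + ?h x) - y) = (Q (?hi x) y - Q (?lo x) y) / ?h x"
      using ev
    proof eventually_elim
      case (elim x)
      have "Q (?hi x) (y + ?h x) = Q (?lo x) y + (E (?hi x) - E (?lo x)) + integral {?lo x..?hi x} (drift (?lo x - y))"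
      proof -
        have "max (?lo x - y) 0 \<le> ?lo x" "-1 \<le> ?lo x - y" "?lo x \<le> ?hi x" "?hi x \<le> ?lo x - y + 1"
          using elim y1 by linarith+
        moreover have "?hi x - (?lo x - y) = y + ?h x" "?lo x - (?lo x - y) = y" by simp_all
        ultimately show ?thesis
          using along_path[of "?lo x - y" "?lo x" "?hi x"] by metis
      qed
      moreover have "integral {?lo x..?hi x} (drift (?lo x - y)) = ?h x * average (drift (?lo x - y)) (?lo x) (?hi x)"
        using elim by (intro integral_eq_average drift_cont) simp
      ultimately have "Q (?hi x) y - Q (?lo x) y = (E (?hi x) - E (?lo x))
          + ?h x * average (drift (?lo x - y)) (?lo x) (?hi x) - (Q (?hi x) (y + ?h x) - Q (?hi x) y)"
        by simp
      moreover have "?h x \<noteq> 0" using elim by simp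
      moreover have "e / h + a - w / (y + h - y) = q / h" if "q = e + h * a - w" "h \<noteq> 0" for q e h a w :: real
        using that by (simp add: add_divide_distrib diff_divide_distrib)
      ultimately show ?case by blast
    qed
    moreover have "dE t + drift (t - y) t - V t y = invN t + K (Q t y) - V t y"
      by (simp add: drift_def invN_def F_def)
    ultimately show "((\<lambda>x. (Q (?hi x) y - Q (?lo x) y) / ?h x) \<longlongrightarrow> invN t + K (Q t y) - V t y) ?G"
      by (simp only: Lim_transform_eventually)
  qed
qed

end

section \<open>Classical solutions and the integral form\<close>

lemma time_interval_Icc: "ereal b < T \<Longrightarrow> {0..b} \<subseteq> time_interval T"
  using le_less_trans[of "ereal _" "ereal b" T] by (auto simp: time_interval_def)

context relaxed_solution
begin

text \<open>
On the history \<open>E'\<close> is the slope of the monotone initial datum, afterwards it is \<open>invN + K 0\<close>.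
\<close>
lemma dE_nonneg:
  assumes mono: "mono_on {0..1} Qi" and K0: "0 \<le> K 0"
    and c: "0 < s \<Longrightarrow> 0 \<le> invN s" and s: "-1 \<le> s"
  shows "0 \<le> dE s"
proof (cases "s \<le> 0")
  case True
  then have y: "- s \<in> {0..1}" using s by simp
  have "0 \<le> Qi' (- s)"
  proof (rule tendsto_lowerbound)
    show "((\<lambda>x. (Qi x - Qi (- s)) / (x - (- s))) \<longlongrightarrow> Qi' (- s)) (at (- s) within {0..1})"
      using Qi_deriv[OF y] by (simp add: has_field_derivative_iff)
    show "\<forall>\<^sub>F x in at (- s) within {0..1}. 0 \<le> (Qi x - Qi (- s)) / (x - (- s))"
    proof -
      have "\<forall>\<^sub>F x in at (- s) within {0..1}. x \<in> {0..1} \<and> x \<noteq> - s"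
        by (simp add: eventually_at_filter)
      then show ?thesis
      proof eventually_elim
        case (elim x)
        show ?case
        proof (cases "x \<le> - s")
          case True
          then show ?thesis using mono_onD[OF mono, of x "- s"] elim y
            by (intro divide_nonpos_nonpos) auto
        next
          case False
          then show ?thesis using mono_onD[OF mono, of "- s" x] elim y
            by (intro divide_nonneg_nonneg) auto
        qed
      qed
    qed
    show "at (- s) within {0..1} \<noteq> bot"
      using y by (auto simp: trivial_limit_within intro!: islimpt_closure_open[where s = "{0<..<1}"])
  qed
  then show ?thesis using dE_hist[of s] True s by simp
next
  case False
  then show ?thesis using c K0 by (simp add: invN_def)
qed

lemma relaxed_is_classical:
  assumes mono: "mono_on {0..1} Qi" and K0: "0 \<le> K 0" and T: "0 < T"
    and c_pos: "\<And>t. t \<in> time_interval T \<Longrightarrow> 0 < invN t"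
  shows "classical_solution \<Phi> K Qi T Q (\<lambda>t. 1 / invN t)"
proof -
  let ?I = "time_interval T"
  have I: "0 \<le> t" if "t \<in> ?I" for t using that by (simp add: time_interval_def)
  have I0: "?I \<subseteq> {0..}" using I by auto
  have V_nonneg: "0 \<le> V t y" if t: "t \<in> ?I" and y: "y \<in> {0..1}" for t y
  proof -
    have "0 \<le> invN (t - y)" if "0 < t - y"
    proof -
      have "t - y \<in> ?I"
      proof (rule subsetD)
        show "{0..t} \<subseteq> ?I" using t by (intro time_interval_Icc) (simp add: time_interval_def)
      qed (use that y in auto)
      then show ?thesis using c_pos[of "t - y"] by simp
    qed
    then have "0 \<le> dE (t - y)" using I[OF t] y by (intro dE_nonneg[OF mono K0]) auto
    then show ?thesis by (simp add: V_def stretch_def)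
  qed
  have C1: "C1_with_partials T Q (\<lambda>t y. invN t + K (Q t y) - V t y) V"
    unfolding C1_with_partials_def
  proof (intro conjI ballI)
    fix t y :: real assume t: "t \<in> ?I" and y: "y \<in> {0..1}"
    show "((\<lambda>s. Q s y) has_real_derivative invN t + K (Q t y) - V t y) (at t within ?I)"
      by (rule has_field_derivative_subset[OF Q_deriv_t[OF I[OF t] y] I0])
    show "(Q t has_real_derivative V t y) (at y within {0..1})"
      by (rule Q_deriv_y[OF I[OF t] y])
  next
    have sub: "?I \<times> {0..1} \<subseteq> {0..} \<times> {0..1}" using I0 by auto
    show V: "continuous_on (?I \<times> {0..1}) (\<lambda>(t, y). V t y)"
      by (rule continuous_on_subset[OF V_cont sub])
    have "continuous_on (?I \<times> {0..1}) (\<lambda>z. invN (fst z) + K (Q (fst z) (snd z)) - (\<lambda>(t, y). V t y) z)"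
    proof (intro continuous_on_diff continuous_on_add V)
      show "continuous_on (?I \<times> {0..1}) (\<lambda>z. invN (fst z))"
        by (rule continuous_on_compose2[OF invN_cont]) (use I in \<open>auto intro!: continuous_intros\<close>)
      have "continuous_on UNIV K"
        using K_deriv DERIV_isCont continuous_at_imp_continuous_on by blast
      then show "continuous_on (?I \<times> {0..1}) (\<lambda>z. K (Q (fst z) (snd z)))"
        by (rule continuous_on_compose2) (intro Q_path_cont continuous_intros, simp)
    qed
    then show "continuous_on (?I \<times> {0..1}) (\<lambda>(t, y). invN t + K (Q t y) - V t y)"
      by (simp add: case_prod_unfold)
  qed
  have Q_mono: "mono_on {0..1} (Q t)" if t: "t \<in> ?I" for t
  proof (rule mono_onI)
    fix x y :: real assume xy: "x \<in> {0..1}" "y \<in> {0..1}" "x \<le> y"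
    show "Q t x \<le> Q t y"
    proof (rule DERIV_nonneg_imp_increasing_open[OF xy(3)])
      fix z assume z: "x < z" "z < y"
      then have "(Q t has_real_derivative V t z) (at z)"
        using Q_deriv_y[OF I[OF t], of z] xy by (simp add: at_within_Icc_at)
      then show "\<exists>d. (Q t has_real_derivative d) (at z) \<and> 0 \<le> d"
        using V_nonneg[OF t, of z] xy z by auto
    qed (intro Q_path_cont continuous_intros)
  qed
  show ?thesis
    unfolding classical_solution_def
  proof (rule conjI[OF T], rule exI[of _ "\<lambda>t y. invN t + K (Q t y) - V t y"], rule exI[of _ V],
      intro conjI ballI C1)
    show "continuous_on ?I (\<lambda>t. 1 / invN t)"
      by (intro continuous_intros continuous_on_subset[OF invN_cont I0]) (use c_pos in force)
    show "Q 0 y = Qi y" if "y \<in> {0..1}" for y using that by (rule Q_init)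
    fix t assume t: "t \<in> ?I"
    show "mono_on {0..1} (Q t)" by (rule Q_mono[OF t])
    show "0 < 1 / invN t" using c_pos[OF t] by simp
    show "Q t 0 = 0" using I[OF t] by (rule Q_0)
    show "1 / (1 / invN t) = V t 1 - K \<Phi>" using invN_eq[OF I[OF t]] by simp
    show "K \<Phi> < V t 1" using c_pos[OF t] invN_eq[OF I[OF t]] by simp
    show "invN t + K (Q t y) - V t y + V t y = 1 / (1 / invN t) + K (Q t y)" if "y \<in> {0<..<1}" for y by simp
  qed
qed

end

context relaxed_problem
begin

text \<open>
The differential equation extends by continuity to \<open>y = 0\<close> and \<open>y = 1\<close>.  At \<open>y = 1\<close> it turns into a
homogeneous linear equation for \<open>R t 1 - \<Phi>\<close>, which vanishes initially.  Along a characteristic the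
chain rule and the fundamental theorem give the integral formula.
\<close>
lemma classical_path:
  assumes sol: "classical_solution \<Phi> K Qi T R N" and T1: "0 \<le> T1" "ereal T1 < T"
  shows "\<exists>G. integral_solution T1 R G"
proof -
  let ?I = "time_interval T"
  obtain Rt Re where C1: "C1_with_partials T R Rt Re"
    and N_cont: "continuous_on ?I N" and N_pos: "\<And>t. t \<in> ?I \<Longrightarrow> 0 < N t"
    and pde: "\<And>t y. t \<in> ?I \<Longrightarrow> y \<in> {0<..<1} \<Longrightarrow> Rt t y + Re t y = 1 / N t + K (R t y)"
    and R_0: "\<And>t. t \<in> ?I \<Longrightarrow> R t 0 = 0"
    and N_eq: "\<And>t. t \<in> ?I \<Longrightarrow> 1 / N t = Re t 1 - K \<Phi>"
    and R_init: "\<And>y. y \<in> {0..1} \<Longrightarrow> R 0 y = Qi y"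
    using sol unfolding classical_solution_def by blast
  have Rt: "\<And>t y. t \<in> ?I \<Longrightarrow> y \<in> {0..1} \<Longrightarrow> ((\<lambda>s. R s y) has_real_derivative Rt t y) (at t within ?I)"
    and Re: "\<And>t y. t \<in> ?I \<Longrightarrow> y \<in> {0..1} \<Longrightarrow> (R t has_real_derivative Re t y) (at y within {0..1})"
    and Rt_cont: "continuous_on (?I \<times> {0..1}) (\<lambda>(t, y). Rt t y)"
    and Re_cont: "continuous_on (?I \<times> {0..1}) (\<lambda>(t, y). Re t y)"
    using C1 unfolding C1_with_partials_def by auto
  have sub: "{0..T1} \<subseteq> ?I" by (rule time_interval_Icc[OF T1(2)])
  have total: "((\<lambda>(t, y). R t y) has_derivative (\<lambda>(u, v). u * Rt t y + v * Re t y)) (at (t, y) within ?I \<times> {0..1})"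
    if t: "t \<in> ?I" and y: "y \<in> {0..1}" for t y
  proof -
    have "((\<lambda>(t, y). R t y) has_derivative (\<lambda>(u, v). Rt t y * u + blinfun_apply (blinfun_scaleR_left (Re t y)) v))
        (at (t, y) within ?I \<times> {0..1})"
    proof (rule has_derivative_partialsI[where fx = "\<lambda>u. Rt t y * u" and fy = "\<lambda>t y. blinfun_scaleR_left (Re t y)"])
      show "((\<lambda>x. R x y) has_derivative (\<lambda>u. Rt t y * u)) (at t within ?I)"
        using Rt[OF t y] by (simp add: has_field_derivative_def)
      show "(R x has_derivative blinfun_apply (blinfun_scaleR_left (Re x y))) (at y within {0..1})"
        if "x \<in> ?I" "y \<in> {0..1}" for x y
        using Re[OF that] by (simp add: has_field_derivative_def mult_commute_abs)
      have "continuous_on (?I \<times> {0..1}) (\<lambda>z. blinfun_scaleR_left ((\<lambda>(t, y). Re t y) z))"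
        by (rule bounded_linear.continuous_on[OF bounded_linear_blinfun_scaleR_left Re_cont])
      then show "continuous (at (t, y) within ?I \<times> {0..1}) (\<lambda>(x, y). blinfun_scaleR_left (Re x y))"
        using t y by (simp add: continuous_on_eq_continuous_within case_prod_unfold)
    qed (use y in auto)
    then show ?thesis by (simp add: mult.commute case_prod_unfold)
  qed
  have R_cont: "continuous_on (?I \<times> {0..1}) (\<lambda>(t, y). R t y)"
    unfolding continuous_on_eq_continuous_within using total has_derivative_continuous by blast
  have pde': "Rt t y + Re t y = 1 / N t + K (R t y)" if t: "t \<in> ?I" and y: "y \<in> {0..1}" for t y
  proof -
    have K_cont: "continuous_on UNIV K"
      using K_deriv DERIV_isCont continuous_at_imp_continuous_on by blast
    have line: "continuous_on {0..1} (\<lambda>y. (\<lambda>(t, y). f t y) (t, y))"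
      if "continuous_on (?I \<times> {0..1}) (\<lambda>(t, y). f t y)" for f :: "real \<Rightarrow> real \<Rightarrow> real"
      by (rule continuous_on_compose2[OF that]) (use t in \<open>auto intro!: continuous_intros\<close>)
    have "continuous_on {0..1} (\<lambda>y. Rt t y + Re t y - (1 / N t + K (R t y)))"
      using line[OF Rt_cont] line[OF Re_cont] line[OF R_cont]
      by (auto intro!: continuous_intros continuous_on_compose2[OF K_cont])
    then have "Rt t y + Re t y - (1 / N t + K (R t y)) = 0"
      using continuous_constant_on_closure[of "{0<..<1}" "\<lambda>y. Rt t y + Re t y - (1 / N t + K (R t y))" 0 y]
        pde[OF t] y by simp
    then show ?thesis by simp
  qed
  have along: "((\<lambda>r. R r (r - s)) has_real_derivative (1 / N r + K 0) + F (R r (r - s))) (at r within S)"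
    if "r \<in> S" "S \<subseteq> {0..T1}" "\<And>r. r \<in> S \<Longrightarrow> r - s \<in> {0..1}" for r s S
  proof -
    have p: "((\<lambda>r. (r, r - s)) has_derivative (\<lambda>u. (u, u))) (at r within S)"
      by (auto intro!: derivative_eq_intros)
    have im: "(\<lambda>r. (r, r - s)) ` S \<subseteq> ?I \<times> {0..1}" using that sub by auto
    have r: "r \<in> ?I" "r - s \<in> {0..1}" using that sub by auto
    have "((\<lambda>x. (\<lambda>(t, y). R t y) (x, x - s)) has_derivative
        (\<lambda>u. (\<lambda>(u, v). u * Rt r (r - s) + v * Re r (r - s)) (u, u))) (at r within S)"
      by (rule has_derivative_in_compose[OF p has_derivative_subset[OF total[OF r] im]])
    then have "((\<lambda>r. R r (r - s)) has_real_derivative Rt r (r - s) + Re r (r - s)) (at r within S)"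
      unfolding has_field_derivative_def prod.case
      by (rule has_derivative_eq_rhs) (simp add: fun_eq_iff algebra_simps)
    then show ?thesis using pde'[OF r] by (simp add: F_def)
  qed
  have R_1: "R t 1 = \<Phi>" if t: "t \<in> {0..T1}" for t
  proof -
    have sub_t: "{0..t} \<subseteq> ?I" using t sub by auto
    have "R t 1 - \<Phi> = (R 0 1 - \<Phi>) * exp (integral {0..t} (\<lambda>r. average K' \<Phi> (R r 1)))"
    proof (rule linear_ode_solution)
      have c: "continuous_on {0..t} (\<lambda>r. (\<lambda>(t, y). R t y) (r, 1))"
        by (rule continuous_on_compose2[OF R_cont]) (use sub_t in \<open>auto intro!: continuous_intros\<close>)
      have "continuous_on UNIV (\<lambda>(x :: real, r). K' r)"
        unfolding case_prod_unfold by (rule continuous_on_compose2[OF K'_cont]) (auto intro!: continuous_intros)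
      from continuous_on_average[OF this continuous_on_const c]
      show "continuous_on {0..t} (\<lambda>r. average K' \<Phi> (R r 1))" by simp
      fix r assume r: "r \<in> {0..t}"
      then have rI: "r \<in> ?I" using sub_t by auto
      have "Rt r 1 = K (R r 1) - K \<Phi>" using pde'[OF rI, of 1] N_eq[OF rI] by simp
      also have "\<dots> = average K' \<Phi> (R r 1) * (R r 1 - \<Phi>)" by (rule increment_eq_average[OF K_deriv])
      finally have "((\<lambda>r. R r 1) has_real_derivative average K' \<Phi> (R r 1) * (R r 1 - \<Phi>)) (at r within {0..t})"
        using has_field_derivative_subset[OF Rt[OF rI, of 1] sub_t] by simp
      from DERIV_diff[OF this DERIV_const[of \<Phi>]]
      show "((\<lambda>r. R r 1 - \<Phi>) has_real_derivative average K' \<Phi> (R r 1) * (R r 1 - \<Phi>)) (at r within {0..t})"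
        by simp
    qed (use t in simp)
    then show ?thesis using R_init[of 1] by (simp add: Qi_1)
  qed
  define C where "C s = integral {0..s} (\<lambda>r. 1 / N r + K 0)" for s
  define G where "G s = (if s \<le> 0 then - Qi (- s) else C s)" for s
  have forcing: "continuous_on {0..T1} (\<lambda>r. 1 / N r + K 0)"
    by (intro continuous_intros continuous_on_subset[OF N_cont sub]) (use N_pos sub in force)
  have G_pos: "G s = C s" if "0 \<le> s" for s
    using that by (auto simp: G_def C_def Qi_0)
  have eq: "R t y = G t - G (t - y) + gain R t y" if t: "t \<in> {0..T1}" and y: "y \<in> {0..1}" for t y
  proof -
    let ?a = "max (t - y) 0" and ?s = "t - y"
    have a: "?a \<le> t" using t y by auto
    have int: "((\<lambda>r. (1 / N r + K 0) + F (R r (r - ?s))) has_integral R t (t - ?s) - R ?a (?a - ?s)) {?a..t}"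
    proof (rule fundamental_theorem_of_calculus[OF a])
      fix r assume "r \<in> {?a..t}"
      then have "((\<lambda>r. R r (r - ?s)) has_real_derivative (1 / N r + K 0) + F (R r (r - ?s))) (at r within {?a..t})"
        by (rule along) (use t y in auto)
      then show "((\<lambda>r. R r (r - ?s)) has_vector_derivative (1 / N r + K 0) + F (R r (r - ?s))) (at r within {?a..t})"
        by (simp add: has_real_derivative_iff_has_vector_derivative)
    qed
    have f: "(\<lambda>r. 1 / N r + K 0) integrable_on {?a..t}"
      by (rule integrable_continuous_real, rule continuous_on_subset[OF forcing]) (use t in auto)
    have "(\<lambda>r. F (R r (r - ?s))) integrable_on {?a..t}"
      by (intro integrable_continuous_real gain_integrand_cont y continuous_on_subset[OF R_cont])
         (use t sub in auto)
    from integral_add[OF f this] integral_unique[OF int]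
    have "R t y - R ?a (?a - ?s) = integral {?a..t} (\<lambda>r. 1 / N r + K 0) + gain R t y"
      by (simp add: gain_def)
    moreover have "C ?a + integral {?a..t} (\<lambda>r. 1 / N r + K 0) = C t"
      unfolding C_def
      by (rule Henstock_Kurzweil_Integration.integral_combine[OF _ a integrable_continuous_real])
         (use t in \<open>auto intro: continuous_on_subset[OF forcing]\<close>)
    moreover have "R ?a (?a - ?s) - C ?a = - G ?s"
    proof (cases "?s \<le> 0")
      case True
      then show ?thesis using R_init[of "- ?s"] t y by (simp add: G_def C_def max_def)
    next
      case False
      then have "?s \<in> ?I" using sub t y by (auto intro!: subsetD[OF sub])
      then show ?thesis using False R_0[of ?s] by (simp add: G_def)
    qed
    moreover have "G t = C t" using t by (simp add: G_pos)
    ultimately show ?thesis by simp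
  qed
  have "continuous_on {-1..T1} G"
  proof -
    have "continuous_on {-1..0} (\<lambda>s. - Qi (- s))"
      by (intro continuous_on_minus continuous_on_compose2[OF Qi_cont]) (auto intro!: continuous_intros)
    then have 1: "continuous_on {-1..0} G" by (rule continuous_on_eq) (simp add: G_def)
    have "continuous_on {0..T1} C"
      unfolding C_def by (rule indefinite_integral_continuous_1[OF integrable_continuous_real[OF forcing]])
    then have 2: "continuous_on {0..T1} G" by (rule continuous_on_eq) (simp add: G_pos)
    have "{-1..T1} = {-1..0} \<union> {0..T1}" using T1 by auto
    then show ?thesis using continuous_on_closed_Un[OF _ _ 1 2] by simp
  qed
  moreover have "continuous_on ({0..T1} \<times> {0..1}) (\<lambda>(t, y). R t y)"
    by (rule continuous_on_subset[OF R_cont]) (use sub in auto)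
  moreover have "\<forall>s\<in>{-1..0}. G s = - Qi (- s)" by (simp add: G_def)
  ultimately show ?thesis
    unfolding integral_solution_def using eq R_1 by blast
qed

end

context relaxed_solution
begin

text \<open>
The values of a classical solution are those of \<open>Q\<close>, and \<open>N\<close> is recovered from the slope at \<open>y = 1\<close>.
In particular \<open>invN\<close> is positive throughout the lifetime of any classical solution.
\<close>
lemma classical_solution_unique:
  assumes sol: "classical_solution \<Phi> K Qi T R N" and t: "t \<in> time_interval T"
  shows "y \<in> {0..1} \<Longrightarrow> R t y = Q t y" and "0 < invN t" and "N t = 1 / invN t"
proof -
  have t0: "0 \<le> t" "ereal t < T" using t by (auto simp: time_interval_def)
  from classical_path[OF sol this] obtain G where "integral_solution t R G" ..
  from integral_solution_unique(2)[OF this QE, of t]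
  show eq: "R t y = Q t y" if "y \<in> {0..1}" for y using t0 that by simp
  obtain Rt Re where C1: "C1_with_partials T R Rt Re" and N: "0 < N t" "1 / N t = Re t 1 - K \<Phi>"
    using sol t unfolding classical_solution_def by blast
  have "(R t has_real_derivative Re t 1) (at 1 within {0..1})"
    using C1 t unfolding C1_with_partials_def by auto
  then have "(Q t has_real_derivative Re t 1) (at 1 within {0..1})"
    by (rule has_field_derivative_transform_within[OF _ zero_less_one]) (simp_all add: eq)
  then have "Re t 1 = V t 1"
    using Q_deriv_y[OF t0(1), of 1] by (intro real_derivative_unique_Icc[of 0 1 1 "{0..1}" "Q t"]) auto
  then have "invN t = 1 / N t" using N(2) invN_eq[OF t0(1)] by simp
  then show "0 < invN t" "N t = 1 / invN t" using N(1) by simp_all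
qed

end

section \<open>Maximal existence time and blow-up\<close>

theorem theorem3p1:
  fixes \<Phi>\<^sub>F :: real
    and K K' K'' Qinit Qinit' :: "real \<Rightarrow> real"
    and \<tau>star :: ereal
  assumes \<Phi>F_pos: "0 < \<Phi>\<^sub>F"
    and K_deriv: "\<And>x. (K has_real_derivative K' x) (at x)"
    and K'_deriv: "\<And>x. (K' has_real_derivative K'' x) (at x)"
    and K''_cont: "continuous_on UNIV K''"
    and K'_bounded: "bounded (range K')"
    and K''_bounded: "bounded (range K'')"
    and K_pos: "\<And>x. x \<in> {0..\<Phi>\<^sub>F} \<Longrightarrow> 0 < K x"
    and Qinit_deriv: "\<And>\<eta>. \<eta> \<in> {0..1} \<Longrightarrow> (Qinit has_real_derivative Qinit' \<eta>) (at \<eta> within {0..1})"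
    and Qinit'_cont: "continuous_on {0..1} Qinit'"
    and Qinit_mono: "mono_on {0..1} Qinit"
    and Qinit_0: "Qinit 0 = 0"
    and Qinit_1: "Qinit 1 = \<Phi>\<^sub>F"
    and Qinit'_1: "K \<Phi>\<^sub>F < Qinit' 1"
    and compatibility: "Qinit' 1 - Qinit' 0 = K \<Phi>\<^sub>F - K 0"
  defines "\<tau>star \<equiv> maximal_existence_time \<Phi>\<^sub>F K Qinit"
  shows "0 < \<tau>star \<and>
    (\<exists>Q N. classical_solution \<Phi>\<^sub>F K Qinit \<tau>star Q N \<and>
       (\<forall>Q' N'. classical_solution \<Phi>\<^sub>F K Qinit \<tau>star Q' N' \<longrightarrow>
          (\<forall>\<tau>\<in>time_interval \<tau>star. N' \<tau> = N \<tau> \<and> (\<forall>\<eta>\<in>{0..1}. Q' \<tau> \<eta> = Q \<tau> \<eta>))) \<and>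
       (\<tau>star < \<infinity> \<longrightarrow> filterlim N at_top (at_left (real_of_ereal \<tau>star))))"
proof -
  obtain B where B: "\<And>x. \<bar>K' x\<bar> \<le> B"
    using K'_bounded unfolding bounded_iff by auto
  interpret relaxed_problem \<Phi>\<^sub>F K K' "max B 1" Qinit Qinit'
  proof
    show "continuous_on UNIV K'"
      using K'_deriv DERIV_isCont continuous_at_imp_continuous_on by blast
    show "\<bar>K' x\<bar> \<le> max B 1" for x using B[of x] by simp
  qed (use assms in auto)
  obtain Q E where "continuous_on UNIV (\<lambda>(t, y). Q t y)" "\<And>T. integral_solution T Q E"
    using integral_solution_exists by blast
  then interpret relaxed_solution \<Phi>\<^sub>F K K' "max B 1" Qinit Qinit' Q E
    by unfold_locales
  have K0: "0 \<le> K 0" using K_pos[of 0] \<Phi>F_pos by simp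
  define Z where "Z = {t \<in> {0..}. invN t \<le> 0}"
  define T where "T = (if Z = {} then \<infinity> else ereal (Inf Z))"
  have Z_bdd: "bdd_below Z" unfolding Z_def by (rule bdd_belowI[of _ 0]) simp
  have c0: "0 < invN 0"
    using Qinit'_1 dE_hist[of "-1"] by (simp add: invN_eq V_def stretch_at_0)
  have Z_min: "Inf Z \<in> Z" if "Z \<noteq> {}"
  proof (rule closed_contains_Inf[OF that Z_bdd])
    have "closed ({0..} \<inter> invN -` {..0})"
      by (rule continuous_closed_preimage[OF invN_cont]) auto
    then show "closed Z" by (simp add: Z_def vimage_def Int_def)
  qed
  have c_pos: "0 < invN t" if "t \<in> time_interval T" for t
  proof (rule ccontr)
    assume "\<not> 0 < invN t"
    then have "t \<in> Z" using that by (simp add: Z_def time_interval_def)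
    then show False
      using that cInf_lower[OF _ Z_bdd, of t] by (auto simp: T_def time_interval_def split: if_splits)
  qed
  have T_pos: "0 < T"
  proof (cases "Z = {}")
    case False
    then have "0 \<le> Inf Z" "Inf Z \<noteq> 0" using Z_min c0 by (auto simp: Z_def)
    then show ?thesis using False by (simp add: T_def zero_ereal_def)
  qed (simp add: T_def)
  have sol: "classical_solution \<Phi>\<^sub>F K Qinit T Q (\<lambda>t. 1 / invN t)"
    by (rule relaxed_is_classical[OF Qinit_mono K0 T_pos c_pos])
  have T_max: "S \<le> T" if "classical_solution \<Phi>\<^sub>F K Qinit S R N" for S R N
  proof (rule ccontr)
    assume "\<not> S \<le> T"
    then have lt: "T < S" by simp
    then have ne: "Z \<noteq> {}" by (auto simp: T_def)
    have "0 \<le> Inf Z" using Z_min[OF ne] unfolding Z_def by blast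
    moreover have "T = ereal (Inf Z)" using ne by (simp add: T_def)
    ultimately have "Inf Z \<in> time_interval S" using lt by (simp add: time_interval_def)
    from classical_solution_unique(2)[OF that this] show False
      using Z_min[OF ne] unfolding Z_def by simp
  qed
  have T_eq: "\<tau>star = T"
    unfolding \<tau>star_def maximal_existence_time_def
    by (rule antisym) (use sol T_max in \<open>auto intro: Sup_least Sup_upper\<close>)
  have N_lim: "filterlim (\<lambda>t. 1 / invN t) at_top (at_left (real_of_ereal T))" if "T < \<infinity>"
  proof -
    have ne: "Z \<noteq> {}" using that by (auto simp: T_def)
    let ?z = "Inf Z"
    have Tz: "T = ereal ?z" using ne by (simp add: T_def)
    then have z: "0 < ?z" "invN ?z \<le> 0"
      using T_pos Z_min[OF ne] unfolding Z_def by simp_all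
    have "(invN \<longlongrightarrow> invN ?z) (at ?z within {0..})"
      using invN_cont z by (simp add: continuous_on_def)
    then have lim: "(invN \<longlongrightarrow> invN ?z) (at ?z within {0..<?z})"
      by (rule tendsto_within_subset) auto
    have left: "at ?z within {0..<?z} = at_left ?z"
      by (rule at_within_nhd[of ?z "{0<..}"]) (use z in auto)
    have pos: "\<forall>\<^sub>F t in at_left ?z. 0 < invN t"
      unfolding left[symmetric] eventually_at_filter
      by (intro always_eventually) (auto intro!: c_pos simp: time_interval_def Tz)
    \<comment> \<open>At the first zero the value is nonpositive since \<open>Inf Z\<close> lies in \<open>Z\<close>, and nonnegative as a limit from the left.\<close>
    have "0 \<le> invN ?z"
      using lim unfolding left
      by (rule tendsto_lowerbound) (use pos in \<open>auto elim: eventually_mono\<close>)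
    then have "(invN \<longlongrightarrow> 0) (at_left ?z)" using lim z unfolding left by simp
    from filterlim_inverse_at_top[OF this pos] show ?thesis
      by (simp add: Tz divide_inverse)
  qed
  show ?thesis
    unfolding T_eq
  proof (intro conjI exI[of _ Q] exI[of _ "\<lambda>t. 1 / invN t"] allI impI ballI T_pos sol N_lim)
    fix R N t y
    assume R: "classical_solution \<Phi>\<^sub>F K Qinit T R N" and t: "t \<in> time_interval T"
    show "N t = 1 / invN t" by (rule classical_solution_unique(3)[OF R t])
    show "R t y = Q t y" if "y \<in> {0..1}" by (rule classical_solution_unique(1)[OF R t that])
  qed
qed

end
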